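(* Let $\Omega\subset\mathbb{R}^d$ be open, let $F:H^1_0(\Omega)\to H^{-1}(\Omega)$ be a (possibly nonlinear) $C^1$ operator, and let $u\in H^1_0(\Omega)$ satisfy $\langle F(u),v\rangle=0$ for all $v\in H^1_0(\Omega)$. Let $\{\phi_i\}_{i=1}^p$ be a partition of unity subordinate to an open cover $\{\Omega_i\}_{i=1}^p$ of $\Omega$. For $i=1,\dots,p$ let $V_i^g\subset H^1_0(\Omega)$ be a subspace, let $u_i^g\in V_i^g$ satisfy $\langle F(u_i^g),v\rangle=0$ for all $v\in V_i^g$, and let $u_{pp}=\sum_{i=1}^p\phi_iu_i^g$ be the PPUM approximation. Let $l$ be a linear functional with Riesz representer $\psi$, i.e. $l(v)=(v,\psi)_{L^2(\Omega)}$. For each $i$ let $\omega_i\in H^1_0(\Omega)$ be a solution (assumed to exist) of the global dual problem with localized data $$(\mathcal{A}_i^T\omega_i,v)_{L^2(\Omega)}=(\phi_i\psi,v)_{L^2(\Omega)}\qquad\forall v\in H^1_0(\Omega),$$ where $\mathcal{A}_i=\int_0^1DF\big(u+\xi(u_i^g-u)\big)\,d\xi$. Then $$l(u-u_{pp})=-\sum_{i=1}^p\langle F(u_i^g),\omega_i\rangle.$$ Moreover, if for some $\epsilon>0$ $$\left|\langle F(u_i^g),\omega_i\rangle\right|<\frac{\epsilon}{p},\qquad i=1,\dots,p,$$ then $$\left|l(u-u_{pp})\right|<\epsilon.$$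
   Context: $\langle\cdot,\cdot\rangle$ is the duality pairing between $H^{-1}(\Omega)$ and $H^1_0(\Omega)$, extending the $L^2(\Omega)$ inner product. $DF(w):H^1_0(\Omega)\to H^{-1}(\Omega)$ is the Fréchet derivative of $F$ at $w$. $\mathcal{A}_i:H^1_0(\Omega)\to H^{-1}(\Omega)$ is the averaged linearization of $F$ between $u$ and $u_i^g$, and $\mathcal{A}_i^T:H^1_0(\Omega)\to H^{-1}(\Omega)$ is its adjoint, defined by $\langle\mathcal{A}_i^Tw,v\rangle=\langle\mathcal{A}_iv,w\rangle$ for all $v,w\in H^1_0(\Omega)$; the expression $(\mathcal{A}_i^T\omega_i,v)_{L^2(\Omega)}$ is understood as $\langle\mathcal{A}_i^T\omega_i,v\rangle$. Partition of unity subordinate to $\{\Omega_i\}$: continuous bounded functions $\phi_i$ on $\Omega$ with $\operatorname{supp}\phi_i\subset\overline{\Omega}_i$ and $\sum_{i=1}^p\phi_i(x)=1$ for all $x\in\Omega$. The Riesz representer $\psi$ is taken in $L^2(\Omega)$. Solvability of the local (subspace) problems and of the dual problems is a standing assumption. *)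

theory Defs
  imports "HOL-Analysis.Analysis"
begin

text \<open>
  Elements of the Lebesgue and Sobolev spaces on an open set \<Omega> are represented by functions on the
  whole space of which only the values on \<Omega> matter; representatives that agree almost everywhere
  on \<Omega> are at (semi)norm distance zero.  HOL types cannot depend on the term \<Omega>, so these spaces
  are carrier sets, and dual spaces, operators, derivatives and operator-valued integrals are taken
  relative to the carriers.
\<close>

definition L2 :: "'a::euclidean_space set \<Rightarrow> ('a \<Rightarrow> real) set" where
  "L2 \<Omega> = {f. set_borel_measurable lebesgue \<Omega> f \<and> set_integrable lebesgue \<Omega> (\<lambda>x. (f x)\<^sup>2)}"

definition L2_inner :: "'a::euclidean_space set \<Rightarrow> ('a \<Rightarrow> real) \<Rightarrow> ('a \<Rightarrow> real) \<Rightarrow> real" where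
  "L2_inner \<Omega> f g = (LINT x:\<Omega>|lebesgue. f x * g x)"

primrec C_k :: "nat \<Rightarrow> ('a::euclidean_space \<Rightarrow> real) \<Rightarrow> bool" where
  "C_k 0 f \<longleftrightarrow> continuous_on UNIV f"
| "C_k (Suc k) f \<longleftrightarrow> (\<forall>x. f differentiable (at x)) \<and>
     (\<forall>b\<in>Basis. C_k k (\<lambda>x. frechet_derivative f (at x) b))"

definition test_functions :: "'a::euclidean_space set \<Rightarrow> ('a \<Rightarrow> real) set" where
  "test_functions \<Omega> = {\<phi>. (\<forall>k. C_k k \<phi>) \<and>
     compact (closure {x. \<phi> x \<noteq> 0}) \<and> closure {x. \<phi> x \<noteq> 0} \<subseteq> \<Omega>}"

definition has_weak_gradient ::
    "'a::euclidean_space set \<Rightarrow> ('a \<Rightarrow> real) \<Rightarrow> ('a \<Rightarrow> 'a) \<Rightarrow> bool" where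
  "has_weak_gradient \<Omega> v G \<longleftrightarrow> (\<forall>b\<in>Basis. (\<lambda>x. G x \<bullet> b) \<in> L2 \<Omega> \<and>
     (\<forall>\<phi>\<in>test_functions \<Omega>.
        L2_inner \<Omega> v (\<lambda>x. frechet_derivative \<phi> (at x) b) = - L2_inner \<Omega> (\<lambda>x. G x \<bullet> b) \<phi>))"

definition H1 :: "'a::euclidean_space set \<Rightarrow> ('a \<Rightarrow> real) set" where
  "H1 \<Omega> = {v \<in> L2 \<Omega>. \<exists>G. has_weak_gradient \<Omega> v G}"

text \<open>
  The weak gradient is unique almost everywhere on \<Omega>, so for an element of $H^1(\Omega)$ the infimum
  is taken over a one-element set; it only avoids choosing a representative of the gradient.
\<close>

definition H1_norm :: "'a::euclidean_space set \<Rightarrow> ('a \<Rightarrow> real) \<Rightarrow> real" where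
  "H1_norm \<Omega> v = Inf {sqrt (L2_inner \<Omega> v v + (\<Sum>b\<in>Basis. L2_inner \<Omega> (\<lambda>x. G x \<bullet> b) (\<lambda>x. G x \<bullet> b))) | G.
     has_weak_gradient \<Omega> v G}"

definition H10 :: "'a::euclidean_space set \<Rightarrow> ('a \<Rightarrow> real) set" where
  "H10 \<Omega> = {v \<in> H1 \<Omega>. \<forall>e>0. \<exists>\<phi>\<in>test_functions \<Omega>. H1_norm \<Omega> (\<lambda>x. v x - \<phi> x) < e}"

definition fun_subspace :: "('a \<Rightarrow> real) set \<Rightarrow> bool" where
  "fun_subspace V \<longleftrightarrow> (\<lambda>x. 0) \<in> V \<and> (\<forall>v\<in>V. \<forall>w\<in>V. (\<lambda>x. v x + w x) \<in> V) \<and>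
     (\<forall>c. \<forall>v\<in>V. (\<lambda>x. c * v x) \<in> V)"

text \<open>The duality pairing of a functional \<open>L\<close> with \<open>v\<close> is the value \<open>L v\<close>.\<close>

definition Hm1 :: "'a::euclidean_space set \<Rightarrow> (('a \<Rightarrow> real) \<Rightarrow> real) set" where
  "Hm1 \<Omega> = {L. (\<forall>v\<in>H10 \<Omega>. \<forall>w\<in>H10 \<Omega>. L (\<lambda>x. v x + w x) = L v + L w) \<and>
     (\<forall>c. \<forall>v\<in>H10 \<Omega>. L (\<lambda>x. c * v x) = c * L v) \<and>
     (\<exists>C. \<forall>v\<in>H10 \<Omega>. \<bar>L v\<bar> \<le> C * H1_norm \<Omega> v)}"

definition Hm1_norm :: "'a::euclidean_space set \<Rightarrow> (('a \<Rightarrow> real) \<Rightarrow> real) \<Rightarrow> real" where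
  "Hm1_norm \<Omega> L = (SUP v\<in>{v \<in> H10 \<Omega>. H1_norm \<Omega> v \<le> 1}. \<bar>L v\<bar>)"

definition bounded_operators ::
    "'a::euclidean_space set \<Rightarrow> (('a \<Rightarrow> real) \<Rightarrow> ('a \<Rightarrow> real) \<Rightarrow> real) set" where
  "bounded_operators \<Omega> = {T. (\<forall>w\<in>H10 \<Omega>. T w \<in> Hm1 \<Omega>) \<and>
     (\<forall>w\<in>H10 \<Omega>. \<forall>z\<in>H10 \<Omega>. \<forall>v\<in>H10 \<Omega>. T (\<lambda>x. w x + z x) v = T w v + T z v) \<and>
     (\<forall>c. \<forall>w\<in>H10 \<Omega>. \<forall>v\<in>H10 \<Omega>. T (\<lambda>x. c * w x) v = c * T w v) \<and>
     (\<exists>C. \<forall>w\<in>H10 \<Omega>. Hm1_norm \<Omega> (T w) \<le> C * H1_norm \<Omega> w)}"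

definition op_norm ::
    "'a::euclidean_space set \<Rightarrow> (('a \<Rightarrow> real) \<Rightarrow> ('a \<Rightarrow> real) \<Rightarrow> real) \<Rightarrow> real" where
  "op_norm \<Omega> T = (SUP w\<in>{w \<in> H10 \<Omega>. H1_norm \<Omega> w \<le> 1}. Hm1_norm \<Omega> (T w))"

definition adjoint_op ::
    "(('a \<Rightarrow> real) \<Rightarrow> ('a \<Rightarrow> real) \<Rightarrow> real) \<Rightarrow> ('a \<Rightarrow> real) \<Rightarrow> ('a \<Rightarrow> real) \<Rightarrow> real" where
  "adjoint_op T = (\<lambda>w v. T v w)"

definition has_frechet_derivative_at ::
    "'a::euclidean_space set \<Rightarrow> (('a \<Rightarrow> real) \<Rightarrow> ('a \<Rightarrow> real) \<Rightarrow> real) \<Rightarrow>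
     (('a \<Rightarrow> real) \<Rightarrow> ('a \<Rightarrow> real) \<Rightarrow> real) \<Rightarrow> ('a \<Rightarrow> real) \<Rightarrow> bool" where
  "has_frechet_derivative_at \<Omega> F T w \<longleftrightarrow> T \<in> bounded_operators \<Omega> \<and>
     (\<forall>e>0. \<exists>d>0. \<forall>h\<in>H10 \<Omega>. H1_norm \<Omega> h < d \<longrightarrow>
        Hm1_norm \<Omega> (\<lambda>v. F (\<lambda>x. w x + h x) v - F w v - T h v) \<le> e * H1_norm \<Omega> h)"

text \<open>
  \<open>DF\<close> is the derivative of the $C^1$ operator \<open>F\<close>.  Differentiability at \<open>w\<close> in the direction of an
  \<open>h\<close> of norm zero forces \<open>F (w + h) = F w\<close>, so such an \<open>F\<close> is well defined on equivalence classes.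
\<close>

definition C1_operator ::
    "'a::euclidean_space set \<Rightarrow> (('a \<Rightarrow> real) \<Rightarrow> ('a \<Rightarrow> real) \<Rightarrow> real) \<Rightarrow>
     (('a \<Rightarrow> real) \<Rightarrow> ('a \<Rightarrow> real) \<Rightarrow> ('a \<Rightarrow> real) \<Rightarrow> real) \<Rightarrow> bool" where
  "C1_operator \<Omega> F DF \<longleftrightarrow> (\<forall>w\<in>H10 \<Omega>. F w \<in> Hm1 \<Omega>) \<and>
     (\<forall>w\<in>H10 \<Omega>. has_frechet_derivative_at \<Omega> F (DF w) w) \<and>
     (\<forall>w\<in>H10 \<Omega>. \<forall>e>0. \<exists>d>0. \<forall>z\<in>H10 \<Omega>. H1_norm \<Omega> (\<lambda>x. z x - w x) < d \<longrightarrow>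
        op_norm \<Omega> (\<lambda>h v. DF z h v - DF w h v) < e)"

text \<open>
  The operator-valued integral over the unit interval is the limit of Riemann sums in the operator
  norm, along the filter of tagged divisions that also defines \<open>has_integral\<close>.  Its values on
  $H^1_0(\Omega)$ are unique.
\<close>

definition has_op_integral ::
    "'a::euclidean_space set \<Rightarrow> (real \<Rightarrow> ('a \<Rightarrow> real) \<Rightarrow> ('a \<Rightarrow> real) \<Rightarrow> real) \<Rightarrow>
     (('a \<Rightarrow> real) \<Rightarrow> ('a \<Rightarrow> real) \<Rightarrow> real) \<Rightarrow> bool" where
  "has_op_integral \<Omega> T A \<longleftrightarrow> A \<in> bounded_operators \<Omega> \<and>
     ((\<lambda>p. op_norm \<Omega> (\<lambda>w v. (\<Sum>(\<xi>,K)\<in>p. measure lborel K * T \<xi> w v) - A w v)) \<longlongrightarrow> 0)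
       (division_filter {0..1})"

definition op_integral ::
    "'a::euclidean_space set \<Rightarrow> (real \<Rightarrow> ('a \<Rightarrow> real) \<Rightarrow> ('a \<Rightarrow> real) \<Rightarrow> real) \<Rightarrow>
     ('a \<Rightarrow> real) \<Rightarrow> ('a \<Rightarrow> real) \<Rightarrow> real" where
  "op_integral \<Omega> T = (SOME A. has_op_integral \<Omega> T A)"

definition averaged_linearization ::
    "'a::euclidean_space set \<Rightarrow> (('a \<Rightarrow> real) \<Rightarrow> ('a \<Rightarrow> real) \<Rightarrow> ('a \<Rightarrow> real) \<Rightarrow> real) \<Rightarrow>
     ('a \<Rightarrow> real) \<Rightarrow> ('a \<Rightarrow> real) \<Rightarrow> ('a \<Rightarrow> real) \<Rightarrow> ('a \<Rightarrow> real) \<Rightarrow> real" where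
  "averaged_linearization \<Omega> DF u w = op_integral \<Omega> (\<lambda>\<xi>. DF (\<lambda>x. u x + \<xi> * (w x - u x)))"

text \<open>The patches need not be contained in \<Omega>; each \<open>\<phi> i\<close> is only considered on \<Omega>.\<close>

definition open_cover :: "'a::euclidean_space set \<Rightarrow> nat \<Rightarrow> (nat \<Rightarrow> 'a set) \<Rightarrow> bool" where
  "open_cover \<Omega> p U \<longleftrightarrow> (\<forall>i\<in>{1..p}. open (U i)) \<and> \<Omega> \<subseteq> (\<Union>i\<in>{1..p}. U i)"

definition partition_of_unity ::
    "'a::euclidean_space set \<Rightarrow> nat \<Rightarrow> (nat \<Rightarrow> 'a set) \<Rightarrow> (nat \<Rightarrow> 'a \<Rightarrow> real) \<Rightarrow> bool" where
  "partition_of_unity \<Omega> p U \<phi> \<longleftrightarrow>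
     (\<forall>i\<in>{1..p}. continuous_on \<Omega> (\<phi> i) \<and> bounded (\<phi> i ` \<Omega>) \<and>
        closure {x\<in>\<Omega>. \<phi> i x \<noteq> 0} \<subseteq> closure (U i)) \<and>
     (\<forall>x\<in>\<Omega>. (\<Sum>i=1..p. \<phi> i x) = 1)"

end

theory Submission
  imports Defs
begin

text \<open>
  The idea is that duality turns a functional of the error into a residual, patch by patch.  Write
  $e_i = u - u_i^g$.  Since the partition functions sum to 1, $u - u_{pp} = \<Sum>_i \<phi>_i e_i$, hence
  $l(u - u_{pp}) = \<Sum>_i (\<phi>_i e_i, \<psi>) = \<Sum>_i (\<phi>_i \<psi>, e_i)$.  The i-th dual problem with test function
  $e_i$ turns the summand into $\<langle>\<A>_i e_i, \<omega>_i\<rangle>$.  The averaged linearization is made so that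
  $\<A>_i (u_i^g - u) = F(u_i^g) - F(u)$, and $F(u) = 0$, so the summand is $-\<langle>F(u_i^g), \<omega>_i\<rangle>$.  The
  second claim is the triangle inequality for the sum.

  The work lies in the mean value identity \<open>averaged_linearization_mean_value\<close>.  The operator
  $\<A>_i$ is a limit of Riemann sums in operator norm, so one has to know that the limit exists
  (\<open>has_op_integral_of_continuous\<close>), that it can be evaluated pointwise
  (\<open>has_op_integral_pointwise\<close>), and that $F$ is differentiable along the segment when tested with a
  fixed function (\<open>C1_operator_line_derivative\<close>); the fundamental theorem of calculus then applies.

  All of this presupposes that \<^const>\<open>H10\<close> is a vector space with a seminorm: the segment from $u$ to
  $u_i^g$ has to stay in the space, and the operator norms have to control values.  Closure under
  sums rests on test functions having weak gradients, that is on integration by parts, which here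
  comes from the translation invariance of Lebesgue measure (\<open>integral_partial_derivative_eq_0\<close>).
\<close>

section \<open>Square integrable functions\<close>

lemma set_borel_measurable_mult:
  fixes f g :: "'a::euclidean_space \<Rightarrow> real"
  assumes "set_borel_measurable M A f" "set_borel_measurable M A g"
  shows "set_borel_measurable M A (\<lambda>x. f x * g x)"
proof -
  have "(\<lambda>x. (indicator A x *\<^sub>R f x) * (indicator A x *\<^sub>R g x)) \<in> borel_measurable M"
    using assms unfolding set_borel_measurable_def by (intro borel_measurable_times)
  moreover have "(\<lambda>x. (indicator A x *\<^sub>R f x) * (indicator A x *\<^sub>R g x))
      = (\<lambda>x. indicator A x *\<^sub>R (f x * g x))"
    by (auto simp: indicator_def)
  ultimately show ?thesis unfolding set_borel_measurable_def by simp
qed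

text \<open>
  The pointwise bound $2|fg| \<le> f^2 + g^2$ dominates the product.
\<close>

lemma L2_mult_integrable:
  assumes "f \<in> L2 \<Omega>" "g \<in> L2 \<Omega>"
  shows "set_integrable lebesgue \<Omega> (\<lambda>x. f x * g x)"
proof (rule set_integrable_bound)
  show "set_integrable lebesgue \<Omega> (\<lambda>x. (f x)\<^sup>2 + (g x)\<^sup>2)"
    using assms by (auto simp: L2_def)
  show "set_borel_measurable lebesgue \<Omega> (\<lambda>x. f x * g x)"
    using assms by (auto simp: L2_def intro: set_borel_measurable_mult)
  have "\<bar>a * b\<bar> \<le> \<bar>a\<^sup>2 + b\<^sup>2\<bar>" for a b :: real
  proof -
    have "2 * (\<bar>a\<bar> * \<bar>b\<bar>) \<le> a\<^sup>2 + b\<^sup>2"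
      using sum_squares_bound[of "\<bar>a\<bar>" "\<bar>b\<bar>"] by simp
    moreover have "0 \<le> \<bar>a\<bar> * \<bar>b\<bar>" by simp
    ultimately show ?thesis unfolding abs_mult by linarith
  qed
  then show "AE x in lebesgue. x \<in> \<Omega> \<longrightarrow> norm (f x * g x) \<le> norm ((f x)\<^sup>2 + (g x)\<^sup>2)"
    by simp
qed

lemma L2_add:
  assumes "f \<in> L2 \<Omega>" "g \<in> L2 \<Omega>"
  shows "(\<lambda>x. f x + g x) \<in> L2 \<Omega>"
proof -
  have "set_borel_measurable lebesgue \<Omega> (\<lambda>x. f x + g x)"
    using assms unfolding L2_def set_borel_measurable_def
    by (auto simp: scaleR_add_right simp del: real_scaleR_def)
  moreover have "set_integrable lebesgue \<Omega> (\<lambda>x. (f x)\<^sup>2 + (g x)\<^sup>2 + 2 * (f x * g x))"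
    using L2_mult_integrable[OF assms] assms by (auto simp: L2_def)
  moreover have "(\<lambda>x. (f x)\<^sup>2 + (g x)\<^sup>2 + 2 * (f x * g x)) = (\<lambda>x. (f x + g x)\<^sup>2)"
    by (auto simp: power2_eq_square algebra_simps)
  ultimately show ?thesis by (simp add: L2_def)
qed

lemma L2_scale:
  assumes "f \<in> L2 \<Omega>"
  shows "(\<lambda>x. c * f x) \<in> L2 \<Omega>"
proof -
  have "(\<lambda>x. c * (indicator \<Omega> x *\<^sub>R f x)) \<in> borel_measurable lebesgue"
    using assms unfolding L2_def set_borel_measurable_def by (intro borel_measurable_times) auto
  then show ?thesis
    using assms by (auto simp: L2_def set_borel_measurable_def power_mult_distrib mult.left_commute)
qed

lemma L2_diff:
  assumes "f \<in> L2 \<Omega>" "g \<in> L2 \<Omega>"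
  shows "(\<lambda>x. f x - g x) \<in> L2 \<Omega>"
  using L2_add[OF assms(1) L2_scale[OF assms(2), of "-1"]] by simp

lemma L2_zero: "(\<lambda>x. 0) \<in> L2 \<Omega>"
  by (simp add: L2_def set_borel_measurable_def set_integrable_def)

lemma L2_sum:
  assumes "\<And>i. i \<in> I \<Longrightarrow> f i \<in> L2 \<Omega>"
  shows "(\<lambda>x. \<Sum>i\<in>I. f i x) \<in> L2 \<Omega>"
  using assms by (induction I rule: infinite_finite_induct) (auto intro: L2_zero L2_add)

lemma L2_inner_commute: "L2_inner \<Omega> f g = L2_inner \<Omega> g f"
  by (simp add: L2_inner_def mult.commute)

lemma L2_inner_add_left:
  assumes "f \<in> L2 \<Omega>" "g \<in> L2 \<Omega>" "h \<in> L2 \<Omega>"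
  shows "L2_inner \<Omega> (\<lambda>x. f x + g x) h = L2_inner \<Omega> f h + L2_inner \<Omega> g h"
  using assms by (simp add: L2_inner_def distrib_right L2_mult_integrable)

lemma L2_inner_scale_left: "L2_inner \<Omega> (\<lambda>x. c * f x) h = c * L2_inner \<Omega> f h"
  by (simp add: L2_inner_def mult.assoc)

lemma L2_inner_add_right:
  assumes "f \<in> L2 \<Omega>" "g \<in> L2 \<Omega>" "h \<in> L2 \<Omega>"
  shows "L2_inner \<Omega> h (\<lambda>x. f x + g x) = L2_inner \<Omega> h f + L2_inner \<Omega> h g"
  using L2_inner_add_left[OF assms] by (simp add: L2_inner_commute)

lemma L2_inner_scale_right: "L2_inner \<Omega> h (\<lambda>x. c * f x) = c * L2_inner \<Omega> h f"
  using L2_inner_scale_left[of \<Omega> c f h] by (simp add: L2_inner_commute)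

lemma L2_inner_self_nonneg: "0 \<le> L2_inner \<Omega> f f"
  unfolding L2_inner_def set_lebesgue_integral_def
  by (rule Bochner_Integration.integral_nonneg) (simp add: indicator_def)

lemma L2_inner_sum_left:
  assumes "\<And>i. i \<in> I \<Longrightarrow> f i \<in> L2 \<Omega>" "g \<in> L2 \<Omega>"
  shows "L2_inner \<Omega> (\<lambda>x. \<Sum>i\<in>I. f i x) g = (\<Sum>i\<in>I. L2_inner \<Omega> (f i) g)"
  using assms
proof (induction I rule: infinite_finite_induct)
  case (insert i I)
  then show ?case
    using L2_inner_add_left[of "f i" \<Omega> "\<lambda>x. \<Sum>i\<in>I. f i x" g] L2_sum[of I f \<Omega>] by simp
qed (auto simp: L2_inner_def set_lebesgue_integral_def)

lemma L2_inner_cong: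
  assumes "\<And>x. x \<in> \<Omega> \<Longrightarrow> f x * g x = f' x * g' x"
  shows "L2_inner \<Omega> f g = L2_inner \<Omega> f' g'"
  unfolding L2_inner_def set_lebesgue_integral_def
  by (rule Bochner_Integration.integral_cong) (auto simp: indicator_def assms)

text \<open>
  Applied to a partition function it shows that both the local pieces of an error and the localized
  dual data \<open>\<phi>\<^sub>i \<psi>\<close> stay square integrable.
\<close>

lemma L2_bounded_continuous_mult:
  assumes \<Omega>: "open \<Omega>" and \<phi>: "continuous_on \<Omega> \<phi>" "bounded (\<phi> ` \<Omega>)" and f: "f \<in> L2 \<Omega>"
  shows "(\<lambda>x. \<phi> x * f x) \<in> L2 \<Omega>"
proof -
  obtain B where B: "\<And>x. x \<in> \<Omega> \<Longrightarrow> \<bar>\<phi> x\<bar> \<le> B"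
    using \<phi>(2) unfolding bounded_iff by auto
  have "(\<lambda>x. indicator \<Omega> x *\<^sub>R \<phi> x) \<in> borel_measurable borel"
    using \<Omega> \<phi>(1) by (intro borel_measurable_continuous_on_indicator) auto
  then have "set_borel_measurable lebesgue \<Omega> \<phi>"
    unfolding set_borel_measurable_def by (intro measurable_completion) simp
  then have m: "set_borel_measurable lebesgue \<Omega> (\<lambda>x. \<phi> x * f x)"
    using f by (intro set_borel_measurable_mult) (auto simp: L2_def)
  have "set_integrable lebesgue \<Omega> (\<lambda>x. (\<phi> x * f x)\<^sup>2)"
  proof (rule set_integrable_bound)
    show "set_integrable lebesgue \<Omega> (\<lambda>x. B\<^sup>2 * (f x)\<^sup>2)"
      using f by (auto simp: L2_def)
    show "set_borel_measurable lebesgue \<Omega> (\<lambda>x. (\<phi> x * f x)\<^sup>2)"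
      unfolding power2_eq_square by (intro set_borel_measurable_mult m)
    have "(\<phi> x)\<^sup>2 \<le> B\<^sup>2" if "x \<in> \<Omega>" for x
      using B[OF that] by (metis abs_ge_zero power2_abs power_mono)
    then show "AE x in lebesgue. x \<in> \<Omega> \<longrightarrow> norm ((\<phi> x * f x)\<^sup>2) \<le> norm (B\<^sup>2 * (f x)\<^sup>2)"
      by (auto simp: power_mult_distrib intro!: mult_right_mono)
  qed
  with m show ?thesis by (simp add: L2_def)
qed

lemma L2_continuous_compact_support:
  fixes f :: "'a::euclidean_space \<Rightarrow> real"
  assumes \<Omega>: "open \<Omega>" and f: "continuous_on UNIV f" and K: "compact K"
    and z: "\<And>x. x \<notin> K \<Longrightarrow> f x = 0"
  shows "f \<in> L2 \<Omega>"
proof -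
  have fm: "f \<in> borel_measurable borel" by (rule borel_measurable_continuous_onI[OF f])
  have "integrable lborel (\<lambda>x. indicator K x *\<^sub>R (f x)\<^sup>2)"
    using K f by (intro borel_integrable_compact continuous_intros) (auto intro: continuous_on_subset)
  moreover have "(\<lambda>x. indicator K x *\<^sub>R (f x)\<^sup>2) = (\<lambda>x. (f x)\<^sup>2)"
    using z by (intro ext) (auto simp: indicator_def)
  ultimately have "integrable lborel (\<lambda>x. (f x)\<^sup>2)" by simp
  then have "integrable lebesgue (\<lambda>x. (f x)\<^sup>2)"
    using fm by (subst integrable_completion) auto
  then have "set_integrable lebesgue \<Omega> (\<lambda>x. (f x)\<^sup>2)"
    unfolding set_integrable_def using \<Omega> by (intro integrable_mult_indicator) auto
  moreover have "set_borel_measurable lebesgue \<Omega> f"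
    unfolding set_borel_measurable_def using \<Omega> fm
    by (intro measurable_completion) auto
  ultimately show ?thesis by (simp add: L2_def)
qed

section \<open>Integration by parts for compactly supported functions\<close>

lemma frechet_derivative_zero_outside_support:
  fixes f :: "'a::euclidean_space \<Rightarrow> real"
  assumes "x \<notin> closure {x. f x \<noteq> 0}"
  shows "frechet_derivative f (at x) b = 0"
proof -
  have "((\<lambda>x. 0) has_derivative (\<lambda>x. 0)) (at x)" by simp
  then have "(f has_derivative (\<lambda>x. 0)) (at x)"
  proof (rule has_derivative_transform_within_open)
    show "open (- closure {x. f x \<noteq> 0})" by (intro open_Compl closed_closure)
    show "x \<in> - closure {x. f x \<noteq> 0}" using assms by simp
    fix y assume "y \<in> - closure {x. f x \<noteq> 0}"
    then show "0 = f y" using closure_subset[of "{x. f x \<noteq> 0}"] by auto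
  qed
  from frechet_derivative_at[OF this] show ?thesis by metis
qed

text \<open>
  By translation invariance every difference quotient of \<open>f\<close> in direction \<open>b\<close> has integral zero.  As
  the step tends to zero the quotients converge pointwise to the directional derivative; the mean
  value theorem bounds them by the supremum of that derivative, and they vanish off one compact set
  as long as the step is at most 1.  Dominated convergence gives the claim.
\<close>

lemma integral_partial_derivative_eq_0:
  fixes f :: "'a::euclidean_space \<Rightarrow> real"
  assumes diff: "\<And>x. f differentiable (at x)"
    and cont: "continuous_on UNIV (\<lambda>x. frechet_derivative f (at x) b)"
    and K: "compact (closure {x. f x \<noteq> 0})"
  shows "integral\<^sup>L lborel (\<lambda>x. frechet_derivative f (at x) b) = 0"
proof -
  define K where "K = closure {x. f x \<noteq> 0}"
  define D where "D x = frechet_derivative f (at x) b" for x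
  have fz: "f x = 0" if "x \<notin> K" for x
    using that closure_subset[of "{x. f x \<noteq> 0}"] by (auto simp: K_def)
  have fcont: "continuous_on UNIV f"
    using diff by (meson differentiable_imp_continuous_on differentiable_on_def
        differentiable_at_withinI)
  have Dcont: "continuous_on A D" for A
    using cont continuous_on_subset unfolding D_def by blast
  have "bounded (D ` K)"
    using K Dcont by (auto simp: K_def intro!: compact_imp_bounded compact_continuous_image)
  then obtain M0 where M0: "\<And>x. x \<in> K \<Longrightarrow> \<bar>D x\<bar> \<le> M0"
    unfolding bounded_iff by auto
  \<comment> \<open>The maximum keeps the bound nonnegative when the support is empty.\<close>
  define M where "M = max M0 0"
  have M: "\<bar>D x\<bar> \<le> M" for x
    using M0[of x] frechet_derivative_zero_outside_support[of x f b]
    by (cases "x \<in> K") (auto simp: M_def K_def D_def)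
  \<comment> \<open>The points from which the support is met by going at most once along \<open>b\<close>.\<close>
  define K' where "K' = (\<lambda>(x,t). x - t *\<^sub>R b) ` (K \<times> {0..1::real})"
  have K': "compact K'"
    unfolding K'_def using K
    by (intro compact_continuous_image compact_Times)
       (auto simp: K_def case_prod_unfold intro!: continuous_intros)
  define h where "h n = inverse (real (Suc n))" for n
  have h: "0 < h n" "h n \<le> 1" for n by (auto simp: h_def field_simps)
  define s where "s n x = (f (x + h n *\<^sub>R b) - f x) / h n" for n x
  have line: "((\<lambda>t. f (x + t *\<^sub>R b)) has_real_derivative D (x + t *\<^sub>R b)) (at t)" for x t
  proof -
    have "(f has_derivative frechet_derivative f (at (x + t *\<^sub>R b))) (at (x + t *\<^sub>R b))"
      using diff frechet_derivative_works by blast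
    moreover have "((\<lambda>t. x + t *\<^sub>R b) has_derivative (\<lambda>s. s *\<^sub>R b)) (at t)"
      by (auto intro!: derivative_eq_intros)
    ultimately have "((\<lambda>t. f (x + t *\<^sub>R b)) has_derivative
        (\<lambda>s. frechet_derivative f (at (x + t *\<^sub>R b)) (s *\<^sub>R b))) (at t)"
      using has_derivative_compose by fastforce
    moreover have "frechet_derivative f (at y) (s *\<^sub>R b) = D y * s" for s y
      using linear_frechet_derivative[OF diff] by (simp add: linear_scale D_def)
    ultimately show ?thesis by (simp add: has_field_derivative_def)
  qed
  have bound: "\<bar>s n x\<bar> \<le> M * indicator K' x" for n x
  proof (cases "x \<in> K'")
    case True
    obtain z where "f (x + h n *\<^sub>R b) - f (x + 0 *\<^sub>R b) = (h n - 0) * D (x + z *\<^sub>R b)"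
      using MVT2[OF h(1)[of n], of "\<lambda>t. f (x + t *\<^sub>R b)" "\<lambda>t. D (x + t *\<^sub>R b)"] line by blast
    then show ?thesis
      using M True h(1)[of n] by (simp add: s_def)
  next
    case False
    have "x + t *\<^sub>R b \<notin> K" if "t \<in> {0..1}" for t
    proof
      assume "x + t *\<^sub>R b \<in> K"
      then have "(\<lambda>(x,t). x - t *\<^sub>R b) (x + t *\<^sub>R b, t) \<in> K'"
        unfolding K'_def using that by blast
      then show False using False by simp
    qed
    from fz[OF this, of "h n"] fz[OF this, of 0] show ?thesis
      using h[of n] False by (auto simp: s_def)
  qed
  have fint: "integrable lborel f"
  proof -
    have "integrable lborel (\<lambda>x. indicator K x *\<^sub>R f x)"
      using K fcont by (intro borel_integrable_compact) (auto simp: K_def intro: continuous_on_subset)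
    moreover have "(\<lambda>x. indicator K x *\<^sub>R f x) = f"
      using fz by (intro ext) (auto simp: indicator_def)
    ultimately show ?thesis by simp
  qed
  have fm: "f \<in> borel_measurable borel" by (rule borel_measurable_continuous_onI[OF fcont])
  have shift: "integrable lborel (\<lambda>x. f (c + x))" "integral\<^sup>L lborel (\<lambda>x. f (c + x)) = integral\<^sup>L lborel f" for c
  proof -
    have "integrable (distr lborel borel ((+) c)) f"
      using fint by (simp add: lborel_distr_plus)
    then show "integrable lborel (\<lambda>x. f (c + x))"
      using fm by (subst (asm) integrable_distr_eq) auto
    have "integral\<^sup>L (distr lborel borel ((+) c)) f = integral\<^sup>L lborel (\<lambda>x. f (c + x))"
      using fm by (intro integral_distr) auto
    then show "integral\<^sup>L lborel (\<lambda>x. f (c + x)) = integral\<^sup>L lborel f"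
      by (simp add: lborel_distr_plus)
  qed
  have s0: "integral\<^sup>L lborel (s n) = 0" for n
    using shift[of "h n *\<^sub>R b"] fint unfolding s_def by (simp add: add.commute)
  have "(\<lambda>n. integral\<^sup>L lborel (s n)) \<longlonglongrightarrow> integral\<^sup>L lborel D"
  proof (rule integral_dominated_convergence)
    show "D \<in> borel_measurable lborel"
      using borel_measurable_continuous_onI[OF Dcont] by simp
    show "s n \<in> borel_measurable lborel" for n
      unfolding s_def using fm by measurable
    have "integrable lborel (indicator K' :: 'a \<Rightarrow> real)"
      using borel_integrable_compact[OF K' continuous_on_const[of K' "1::real"]] by simp
    then show "integrable lborel (\<lambda>x. M * indicator K' x)" by simp
    show "AE x in lborel. norm (s n x) \<le> M * indicator K' x" for n using bound by simp
    have "(\<lambda>n. s n x) \<longlonglongrightarrow> D x" for x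
    proof -
      have "((\<lambda>t. (f (x + t *\<^sub>R b) - f x) / t) \<longlongrightarrow> D x) (at 0)"
        using line[of x 0] unfolding has_field_derivative_iff by simp
      moreover have "filterlim h (at 0) sequentially"
        unfolding filterlim_at
      proof (intro conjI always_eventually allI)
        show "h \<longlonglongrightarrow> 0" unfolding h_def by (rule LIMSEQ_inverse_real_of_nat)
        show "h n \<in> UNIV" "h n \<noteq> 0" for n using h(1)[of n] by simp_all
      qed
      ultimately show ?thesis
        unfolding s_def by (rule filterlim_compose)
    qed
    then show "AE x in lborel. (\<lambda>n. s n x) \<longlonglongrightarrow> D x" by simp
  qed
  then have "(\<lambda>n::nat. 0) \<longlonglongrightarrow> integral\<^sup>L lborel D" by (simp only: s0)
  then have "integral\<^sup>L lborel D = 0" by (rule LIMSEQ_unique[OF _ tendsto_const])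
  then show ?thesis unfolding D_def .
qed

section \<open>Test functions and weak gradients\<close>

lemma C_k_add:
  "C_k k f \<Longrightarrow> C_k k g \<Longrightarrow> C_k k (\<lambda>x. f x + g x)"
proof (induction k arbitrary: f g)
  case 0
  then show ?case by (auto intro: continuous_on_add)
next
  case (Suc k)
  have "frechet_derivative (\<lambda>x. f x + g x) (at x) =
      (\<lambda>b. frechet_derivative f (at x) b + frechet_derivative g (at x) b)" for x
    using Suc.prems
    by (intro frechet_derivative_at[symmetric] has_derivative_add)
       (auto simp: frechet_derivative_works[symmetric])
  with Suc show ?case by (simp add: differentiable_add)
qed

lemma C_k_scale:
  "C_k k f \<Longrightarrow> C_k k (\<lambda>x. c * f x)"
proof (induction k arbitrary: f)
  case 0
  then show ?case by (auto intro: continuous_intros)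
next
  case (Suc k)
  have "frechet_derivative (\<lambda>x. c * f x) (at x) = (\<lambda>b. c * frechet_derivative f (at x) b)" for x
    using Suc.prems
    by (intro frechet_derivative_at[symmetric] has_derivative_mult_right)
       (auto simp: frechet_derivative_works[symmetric])
  with Suc show ?case by (simp add: differentiable_mult)
qed

lemma compact_support_mono:
  assumes "compact (closure {x. f x \<noteq> 0})" "closure {x. f x \<noteq> 0} \<subseteq> \<Omega>"
    and "{x. g x \<noteq> 0} \<subseteq> {x. f x \<noteq> (0::real)}"
  shows "compact (closure {x::'a::euclidean_space. g x \<noteq> (0::real)}) \<and> closure {x. g x \<noteq> 0} \<subseteq> \<Omega>"
  using assms closure_mono[OF assms(3)]
  by (auto simp: compact_eq_bounded_closed intro: bounded_subset)

lemma test_functions_add: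
  assumes "f \<in> test_functions \<Omega>" "g \<in> test_functions \<Omega>"
  shows "(\<lambda>x. f x + g x) \<in> test_functions \<Omega>"
proof -
  have s: "closure {x. f x + g x \<noteq> 0} \<subseteq> closure {x. f x \<noteq> 0} \<union> closure {x. g x \<noteq> 0}"
    unfolding closure_Un[symmetric] by (rule closure_mono) auto
  have "compact (closure {x. f x \<noteq> 0} \<union> closure {x. g x \<noteq> 0})"
    using assms by (auto simp: test_functions_def intro: compact_Un)
  with s have "compact (closure {x. f x + g x \<noteq> 0})"
    unfolding compact_eq_bounded_closed by (meson bounded_subset closed_closure)
  then show ?thesis using s assms by (auto simp: test_functions_def C_k_add)
qed

lemma test_functions_scale:
  assumes "f \<in> test_functions \<Omega>"
  shows "(\<lambda>x. c * f x) \<in> test_functions \<Omega>"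
proof -
  have "compact (closure {x. c * f x \<noteq> 0}) \<and> closure {x. c * f x \<noteq> 0} \<subseteq> \<Omega>"
    by (rule compact_support_mono[of f]) (use assms in \<open>auto simp: test_functions_def\<close>)
  then show ?thesis using assms by (auto simp: test_functions_def C_k_scale)
qed

lemma test_functionD:
  assumes "f \<in> test_functions \<Omega>"
  shows "f differentiable (at x)"
    and "continuous_on UNIV f"
    and "b \<in> Basis \<Longrightarrow> continuous_on UNIV (\<lambda>x. frechet_derivative f (at x) b)"
    and "compact (closure {x. f x \<noteq> 0})" "closure {x. f x \<noteq> 0} \<subseteq> \<Omega>"
    and "x \<notin> closure {x. f x \<noteq> 0} \<Longrightarrow> f x = 0"
proof -
  have "C_k 0 f" "C_k (Suc 0) f" using assms by (auto simp: test_functions_def simp del: C_k.simps)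
  then show "f differentiable (at x)" "continuous_on UNIV f"
    "b \<in> Basis \<Longrightarrow> continuous_on UNIV (\<lambda>x. frechet_derivative f (at x) b)" by auto
  show "compact (closure {x. f x \<noteq> 0})" "closure {x. f x \<noteq> 0} \<subseteq> \<Omega>"
    using assms by (auto simp: test_functions_def)
  show "x \<notin> closure {x. f x \<noteq> 0} \<Longrightarrow> f x = 0" using closure_subset[of "{x. f x \<noteq> 0}"] by auto
qed

lemma zero_test_function: "(\<lambda>x. 0) \<in> test_functions \<Omega>"
proof -
  have "C_k k (\<lambda>x::'a. 0)" for k by (induction k) auto
  then show ?thesis by (simp add: test_functions_def)
qed

lemma test_function_L2:
  assumes "open \<Omega>" "f \<in> test_functions \<Omega>"
  shows "f \<in> L2 \<Omega>"
  using assms by (intro L2_continuous_compact_support[of _ _ "closure {x. f x \<noteq> 0}"] test_functionD(2,4,6))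

lemma test_function_derivative_L2:
  assumes "open \<Omega>" "f \<in> test_functions \<Omega>" "b \<in> Basis"
  shows "(\<lambda>x. frechet_derivative f (at x) b) \<in> L2 \<Omega>"
  using assms
  by (intro L2_continuous_compact_support[of _ _ "closure {x. f x \<noteq> 0}"] test_functionD(3,4)
      frechet_derivative_zero_outside_support)

text \<open>
  The product of two test functions is continuously differentiable with compact support in \<open>\<Omega>\<close>, so
  its partial derivative integrates to zero; the product rule splits that integral in two.
\<close>

lemma test_function_integration_by_parts:
  assumes \<Omega>: "open \<Omega>" and f: "f \<in> test_functions \<Omega>" and g: "g \<in> test_functions \<Omega>"
    and b: "b \<in> Basis"
  shows "L2_inner \<Omega> f (\<lambda>x. frechet_derivative g (at x) b)
    = - L2_inner \<Omega> (\<lambda>x. frechet_derivative f (at x) b) g"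
proof -
  define Df where "Df x = frechet_derivative f (at x) b" for x
  define Dg where "Dg x = frechet_derivative g (at x) b" for x
  have D: "frechet_derivative (\<lambda>x. f x * g x) (at x) =
      (\<lambda>b. f x * frechet_derivative g (at x) b + frechet_derivative f (at x) b * g x)" for x
    using test_functionD(1)[OF f] test_functionD(1)[OF g]
    by (intro frechet_derivative_at[symmetric] has_derivative_mult)
       (auto simp: frechet_derivative_works[symmetric])
  have L: "f \<in> L2 \<Omega>" "g \<in> L2 \<Omega>" "Df \<in> L2 \<Omega>" "Dg \<in> L2 \<Omega>"
    unfolding Df_def Dg_def using assms by (intro test_function_L2 test_function_derivative_L2; simp)+
  have C: "continuous_on UNIV (\<lambda>x. f x * Dg x + Df x * g x)"
    unfolding Df_def Dg_def using f g b by (intro continuous_intros test_functionD(2,3))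
  have "integral\<^sup>L lborel (\<lambda>x. frechet_derivative (\<lambda>x. f x * g x) (at x) b) = 0"
  proof (rule integral_partial_derivative_eq_0)
    show "(\<lambda>x. f x * g x) differentiable (at x)" for x
      using f g by (intro differentiable_mult test_functionD(1))
    show "continuous_on UNIV (\<lambda>x. frechet_derivative (\<lambda>x. f x * g x) (at x) b)"
      using C by (simp add: D Df_def Dg_def)
    have "compact (closure {x. f x * g x \<noteq> 0}) \<and> closure {x. f x * g x \<noteq> 0} \<subseteq> \<Omega>"
      using f by (intro compact_support_mono[of f] test_functionD(4,5)) auto
    then show "compact (closure {x. f x * g x \<noteq> 0})" by simp
  qed
  then have "integral\<^sup>L lborel (\<lambda>x. f x * Dg x + Df x * g x) = 0"
    by (simp add: D Df_def Dg_def)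
  then have "integral\<^sup>L lebesgue (\<lambda>x. f x * Dg x + Df x * g x) = 0"
    using borel_measurable_continuous_onI[OF C] by (subst integral_completion) auto
  moreover have "indicator \<Omega> x *\<^sub>R (f x * Dg x + Df x * g x) = f x * Dg x + Df x * g x" for x
  proof (cases "x \<in> \<Omega>")
    case False
    then have "f x = 0" "g x = 0"
      using test_functionD(5,6)[OF f] test_functionD(5,6)[OF g] by blast+
    then show ?thesis by simp
  qed simp
  ultimately have "(LINT x:\<Omega>|lebesgue. f x * Dg x + Df x * g x) = 0"
    unfolding set_lebesgue_integral_def by (simp only:)
  moreover have "(LINT x:\<Omega>|lebesgue. f x * Dg x + Df x * g x) = L2_inner \<Omega> f Dg + L2_inner \<Omega> Df g"
    using L by (simp add: L2_inner_def L2_mult_integrable)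
  ultimately have "L2_inner \<Omega> f Dg = - L2_inner \<Omega> Df g" by linarith
  then show ?thesis unfolding Df_def[abs_def] Dg_def[abs_def] .
qed

text \<open>
  Test functions lie in \<open>H1\<close>.  This is what makes \<^const>\<open>H10\<close> a vector space: closure under sums
  needs the triangle inequality for the differences \<open>v - \<phi>\<close>, and these must then have weak gradients,
  as otherwise their norm is an infimum over the empty set.
\<close>

lemma test_function_weak_gradient:
  assumes "open \<Omega>" "f \<in> test_functions \<Omega>"
  shows "has_weak_gradient \<Omega> f (\<lambda>x. \<Sum>b\<in>Basis. frechet_derivative f (at x) b *\<^sub>R b)"
  unfolding has_weak_gradient_def
  using assms by (simp add: inner_sum_left_Basis test_function_derivative_L2 test_function_integration_by_parts)

lemma test_function_H1:
  assumes "open \<Omega>" "f \<in> test_functions \<Omega>"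
  shows "f \<in> H1 \<Omega>"
  using assms test_function_weak_gradient test_function_L2 by (auto simp: H1_def)

lemma weak_gradient_add:
  assumes \<Omega>: "open \<Omega>" and vw: "v \<in> L2 \<Omega>" "w \<in> L2 \<Omega>"
    and G: "has_weak_gradient \<Omega> v G" "has_weak_gradient \<Omega> w H"
  shows "has_weak_gradient \<Omega> (\<lambda>x. v x + w x) (\<lambda>x. G x + H x)"
  using assms unfolding has_weak_gradient_def
  by (simp add: inner_add_left L2_add L2_inner_add_left test_function_L2 test_function_derivative_L2)

lemma weak_gradient_scale:
  assumes "has_weak_gradient \<Omega> v G"
  shows "has_weak_gradient \<Omega> (\<lambda>x. c * v x) (\<lambda>x. c *\<^sub>R G x)"
  using assms unfolding has_weak_gradient_def by (simp add: L2_scale L2_inner_scale_left)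

lemma weak_gradient_zero: "has_weak_gradient \<Omega> (\<lambda>x. 0) (\<lambda>x. 0)"
  using L2_inner_scale_left[of \<Omega> 0] by (simp add: has_weak_gradient_def L2_zero)

lemma H1_add:
  assumes "open \<Omega>" "v \<in> H1 \<Omega>" "w \<in> H1 \<Omega>"
  shows "(\<lambda>x. v x + w x) \<in> H1 \<Omega>"
  using assms weak_gradient_add[of \<Omega> v w] L2_add[of v \<Omega> w] unfolding H1_def by blast

lemma H1_scale:
  assumes "v \<in> H1 \<Omega>"
  shows "(\<lambda>x. c * v x) \<in> H1 \<Omega>"
  using assms weak_gradient_scale[of \<Omega> v] L2_scale[of v \<Omega> c] unfolding H1_def by blast

section \<open>The Sobolev seminorm\<close>

text \<open>
  The \<open>H1\<close> inner product with the gradients as explicit arguments: a symmetric, positive semidefinite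
  bilinear form on pairs of a function and one of its weak gradients.  Keeping the gradient as an
  argument makes the form additive in the pair, without appeal to uniqueness of weak gradients.
\<close>

definition graph_form ::
    "'a::euclidean_space set \<Rightarrow> ('a \<Rightarrow> real) \<Rightarrow> ('a \<Rightarrow> 'a) \<Rightarrow> ('a \<Rightarrow> real) \<Rightarrow> ('a \<Rightarrow> 'a) \<Rightarrow> real" where
  "graph_form \<Omega> v G w H = L2_inner \<Omega> v w + (\<Sum>b\<in>Basis. L2_inner \<Omega> (\<lambda>x. G x \<bullet> b) (\<lambda>x. H x \<bullet> b))"

lemma H1_norm_graph_form: "H1_norm \<Omega> v = Inf {sqrt (graph_form \<Omega> v G v G) | G. has_weak_gradient \<Omega> v G}"
  by (simp add: H1_norm_def graph_form_def)

lemma graph_form_nonneg: "0 \<le> graph_form \<Omega> v G v G"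
  by (simp add: graph_form_def L2_inner_self_nonneg sum_nonneg)

lemma graph_form_scale:
  "graph_form \<Omega> (\<lambda>x. c * v x) (\<lambda>x. c *\<^sub>R G x) (\<lambda>x. c * v x) (\<lambda>x. c *\<^sub>R G x) = c\<^sup>2 * graph_form \<Omega> v G v G"
  by (simp add: graph_form_def L2_inner_scale_left L2_inner_scale_right sum_distrib_left
      power2_eq_square algebra_simps)

lemma graph_form_add_scale:
  assumes vw: "v \<in> L2 \<Omega>" "w \<in> L2 \<Omega>"
    and G: "has_weak_gradient \<Omega> v G" "has_weak_gradient \<Omega> w H"
  shows "graph_form \<Omega> (\<lambda>x. v x + t * w x) (\<lambda>x. G x + t *\<^sub>R H x) (\<lambda>x. v x + t * w x) (\<lambda>x. G x + t *\<^sub>R H x)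
    = graph_form \<Omega> v G v G + 2 * t * graph_form \<Omega> v G w H + t\<^sup>2 * graph_form \<Omega> w H w H"
proof -
  have expand: "L2_inner \<Omega> (\<lambda>x. f x + t * g x) (\<lambda>x. f x + t * g x)
      = L2_inner \<Omega> f f + 2 * t * L2_inner \<Omega> f g + t\<^sup>2 * L2_inner \<Omega> g g"
    if "f \<in> L2 \<Omega>" "g \<in> L2 \<Omega>" for f g
    using that L2_inner_commute[of \<Omega> g f]
    by (simp add: L2_inner_add_left L2_inner_add_right L2_inner_scale_left L2_inner_scale_right
        L2_add L2_scale power2_eq_square algebra_simps)
  have "(\<Sum>b\<in>Basis. L2_inner \<Omega> (\<lambda>x. G x \<bullet> b + t * (H x \<bullet> b)) (\<lambda>x. G x \<bullet> b + t * (H x \<bullet> b)))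
      = (\<Sum>b\<in>Basis. L2_inner \<Omega> (\<lambda>x. G x \<bullet> b) (\<lambda>x. G x \<bullet> b)
          + 2 * t * L2_inner \<Omega> (\<lambda>x. G x \<bullet> b) (\<lambda>x. H x \<bullet> b)
          + t\<^sup>2 * L2_inner \<Omega> (\<lambda>x. H x \<bullet> b) (\<lambda>x. H x \<bullet> b))"
    using G by (intro sum.cong refl expand) (auto simp: has_weak_gradient_def)
  then show ?thesis
    unfolding graph_form_def expand[OF vw] inner_add_left inner_scaleR_left
    by (simp add: sum.distrib sum_distrib_left[symmetric] distrib_left)
qed

text \<open>
  Minkowski's inequality for a semidefinite form: nonnegativity of the form along \<open>v + t w\<close> for all
  real \<open>t\<close> gives the Cauchy--Schwarz inequality.
\<close>

lemma graph_form_triangle: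
  assumes vw: "v \<in> L2 \<Omega>" "w \<in> L2 \<Omega>"
    and G: "has_weak_gradient \<Omega> v G" "has_weak_gradient \<Omega> w H"
  shows "sqrt (graph_form \<Omega> (\<lambda>x. v x + w x) (\<lambda>x. G x + H x) (\<lambda>x. v x + w x) (\<lambda>x. G x + H x))
    \<le> sqrt (graph_form \<Omega> v G v G) + sqrt (graph_form \<Omega> w H w H)"
proof -
  define a b c where "a = graph_form \<Omega> v G v G" "b = graph_form \<Omega> w H w H" "c = graph_form \<Omega> v G w H"
  note abc = this
  have ab: "0 \<le> a" "0 \<le> b" by (simp_all add: abc graph_form_nonneg)
  have quad: "0 \<le> a + 2 * t * c + t\<^sup>2 * b" for t
    unfolding abc graph_form_add_scale[OF assms, symmetric] by (rule graph_form_nonneg)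
  have cs: "c\<^sup>2 \<le> a * b"
  proof (cases "b = 0")
    case True
    \<comment> \<open>Otherwise the form would be affine and nonconstant in \<open>t\<close>, hence negative somewhere.\<close>
    have "c = 0"
    proof (rule ccontr)
      assume "c \<noteq> 0"
      then have "2 * (- (a + 1) / (2 * c)) * c = - (a + 1)" by (simp add: field_simps)
      with quad[of "- (a + 1) / (2 * c)"] True show False by simp
    qed
    then show ?thesis using True by simp
  next
    case False
    then have "0 < b" using ab by simp
    \<comment> \<open>The minimum of the quadratic in \<open>t\<close> is at \<open>- c / b\<close>.\<close>
    with quad[of "- c / b"] show ?thesis by (simp add: field_simps power2_eq_square)
  qed
  then have "c \<le> sqrt a * sqrt b"
    by (metis real_le_rsqrt real_sqrt_mult)
  then have "a + 2 * 1 * c + 1\<^sup>2 * b \<le> (sqrt a + sqrt b)\<^sup>2"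
    using ab by (simp add: power2_sum)
  then have "sqrt (a + 2 * 1 * c + 1\<^sup>2 * b) \<le> sqrt a + sqrt b"
    using ab by (intro real_le_lsqrt) auto
  then show ?thesis
    using graph_form_add_scale[OF assms, of 1] by (simp add: abc)
qed

lemma H1_norm_le_graph:
  "has_weak_gradient \<Omega> v G \<Longrightarrow> H1_norm \<Omega> v \<le> sqrt (graph_form \<Omega> v G v G)"
  unfolding H1_norm_graph_form
  by (rule cInf_lower) (auto intro!: bdd_belowI[of _ 0] simp: graph_form_nonneg)

lemma H1_norm_greatest:
  assumes "v \<in> H1 \<Omega>" "\<And>G. has_weak_gradient \<Omega> v G \<Longrightarrow> c \<le> sqrt (graph_form \<Omega> v G v G)"
  shows "c \<le> H1_norm \<Omega> v"
  unfolding H1_norm_graph_form using assms by (intro cInf_greatest) (auto simp: H1_def)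

lemma H1_norm_nonneg: "v \<in> H1 \<Omega> \<Longrightarrow> 0 \<le> H1_norm \<Omega> v"
  by (rule H1_norm_greatest) (auto simp: graph_form_nonneg)

text \<open>
  Any weak gradients of \<open>v\<close> and \<open>w\<close> add up to one of \<open>v + w\<close>, so the inequality for the form passes to
  the infimum in each summand separately.
\<close>

lemma H1_norm_triangle:
  assumes \<Omega>: "open \<Omega>" and v: "v \<in> H1 \<Omega>" and w: "w \<in> H1 \<Omega>"
  shows "H1_norm \<Omega> (\<lambda>x. v x + w x) \<le> H1_norm \<Omega> v + H1_norm \<Omega> w"
proof -
  have L: "v \<in> L2 \<Omega>" "w \<in> L2 \<Omega>" using v w by (auto simp: H1_def)
  have "H1_norm \<Omega> (\<lambda>x. v x + w x) - H1_norm \<Omega> w \<le> H1_norm \<Omega> v"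
  proof (rule H1_norm_greatest[OF v])
    fix G assume G: "has_weak_gradient \<Omega> v G"
    have "H1_norm \<Omega> (\<lambda>x. v x + w x) - sqrt (graph_form \<Omega> v G v G) \<le> H1_norm \<Omega> w"
    proof (rule H1_norm_greatest[OF w])
      fix H assume H: "has_weak_gradient \<Omega> w H"
      show "H1_norm \<Omega> (\<lambda>x. v x + w x) - sqrt (graph_form \<Omega> v G v G) \<le> sqrt (graph_form \<Omega> w H w H)"
        using H1_norm_le_graph[OF weak_gradient_add[OF \<Omega> L G H]] graph_form_triangle[OF L G H] by simp
    qed
    then show "H1_norm \<Omega> (\<lambda>x. v x + w x) - H1_norm \<Omega> w \<le> sqrt (graph_form \<Omega> v G v G)" by simp
  qed
  then show ?thesis by simp
qed

lemma H1_norm_zero: "H1_norm \<Omega> (\<lambda>x. 0) = 0"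
proof -
  have "(\<lambda>x. 0) \<in> H1 \<Omega>" using weak_gradient_zero L2_zero by (auto simp: H1_def)
  moreover have "graph_form \<Omega> (\<lambda>x. 0) (\<lambda>x. 0) (\<lambda>x. 0) (\<lambda>x. 0) = 0"
    using graph_form_scale[of \<Omega> 0] by simp
  ultimately show ?thesis
    using H1_norm_nonneg[of "\<lambda>x. 0" \<Omega>] H1_norm_le_graph[OF weak_gradient_zero, of \<Omega>] by simp
qed

text \<open>
  Scaling a weak gradient yields one inequality; for a nonzero factor, scaling back by its inverse
  yields the other.
\<close>

lemma H1_norm_scale:
  assumes v: "v \<in> H1 \<Omega>"
  shows "H1_norm \<Omega> (\<lambda>x. c * v x) = \<bar>c\<bar> * H1_norm \<Omega> v"
proof -
  have le: "H1_norm \<Omega> (\<lambda>x. c * v x) \<le> \<bar>c\<bar> * H1_norm \<Omega> v" if v: "v \<in> H1 \<Omega>" and c: "c \<noteq> 0" for v c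
  proof -
    have "H1_norm \<Omega> (\<lambda>x. c * v x) / \<bar>c\<bar> \<le> H1_norm \<Omega> v"
    proof (rule H1_norm_greatest[OF v])
      fix G assume "has_weak_gradient \<Omega> v G"
      from H1_norm_le_graph[OF weak_gradient_scale[OF this, of c]]
      show "H1_norm \<Omega> (\<lambda>x. c * v x) / \<bar>c\<bar> \<le> sqrt (graph_form \<Omega> v G v G)"
        using c by (simp add: graph_form_scale real_sqrt_mult field_simps)
    qed
    then show ?thesis using c by (simp add: field_simps)
  qed
  show ?thesis
  proof (cases "c = 0")
    case False
    have "H1_norm \<Omega> (\<lambda>x. (1/c) * (c * v x)) \<le> \<bar>1/c\<bar> * H1_norm \<Omega> (\<lambda>x. c * v x)"
      using le[OF H1_scale[OF v, of c], of "1/c"] False by simp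
    with le[OF v False] False show ?thesis by (simp add: field_simps)
  qed (simp add: H1_norm_zero)
qed

section \<open>The space $H^1_0$ is a vector space\<close>

lemma H10_H1: "v \<in> H10 \<Omega> \<Longrightarrow> v \<in> H1 \<Omega>"
  by (simp add: H10_def)

lemma H10_L2: "v \<in> H10 \<Omega> \<Longrightarrow> v \<in> L2 \<Omega>"
  by (simp add: H10_def H1_def)

lemma H10_zero: "(\<lambda>x. 0) \<in> H10 \<Omega>"
proof -
  have "(\<lambda>x. 0) \<in> H1 \<Omega>" using weak_gradient_zero L2_zero by (auto simp: H1_def)
  then show ?thesis
    using H1_norm_zero[of \<Omega>] unfolding H10_def
    by (auto intro!: bexI[OF _ zero_test_function[of \<Omega>]])
qed

lemma H10_add:
  assumes \<Omega>: "open \<Omega>" and v: "v \<in> H10 \<Omega>" and w: "w \<in> H10 \<Omega>"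
  shows "(\<lambda>x. v x + w x) \<in> H10 \<Omega>"
  unfolding H10_def
proof (intro CollectI conjI allI impI)
  show "(\<lambda>x. v x + w x) \<in> H1 \<Omega>" using assms by (intro H1_add H10_H1)
  fix e :: real assume "e > 0"
  then obtain f g where f: "f \<in> test_functions \<Omega>" "H1_norm \<Omega> (\<lambda>x. v x - f x) < e/2"
    and g: "g \<in> test_functions \<Omega>" "H1_norm \<Omega> (\<lambda>x. w x - g x) < e/2"
    using v w unfolding H10_def by (auto dest!: spec[of _ "e/2"])
  have d: "(\<lambda>x. v x - f x) \<in> H1 \<Omega>" if "v \<in> H10 \<Omega>" "f \<in> test_functions \<Omega>" for v f
    using H1_add[OF \<Omega> H10_H1[OF that(1)] H1_scale[OF test_function_H1[OF \<Omega> that(2)], of "-1"]] by simp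
  have "H1_norm \<Omega> (\<lambda>x. (v x - f x) + (w x - g x)) < e"
    using H1_norm_triangle[OF \<Omega> d[OF v f(1)] d[OF w g(1)]] f(2) g(2) by linarith
  then show "\<exists>\<phi>\<in>test_functions \<Omega>. H1_norm \<Omega> (\<lambda>x. v x + w x - \<phi> x) < e"
    by (intro bexI[OF _ test_functions_add[OF f(1) g(1)]]) (simp add: algebra_simps)
qed

lemma H10_scale:
  assumes \<Omega>: "open \<Omega>" and v: "v \<in> H10 \<Omega>"
  shows "(\<lambda>x. c * v x) \<in> H10 \<Omega>"
  unfolding H10_def
proof (intro CollectI conjI allI impI)
  show "(\<lambda>x. c * v x) \<in> H1 \<Omega>" using assms by (intro H1_scale H10_H1)
  fix e :: real assume e: "e > 0"
  have "e / (\<bar>c\<bar> + 1) > 0" using e by (intro divide_pos_pos) auto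
  with v obtain f where f: "f \<in> test_functions \<Omega>" "H1_norm \<Omega> (\<lambda>x. v x - f x) < e / (\<bar>c\<bar> + 1)"
    unfolding H10_def by (auto dest!: spec[of _ "e / (\<bar>c\<bar> + 1)"])
  have d: "(\<lambda>x. v x - f x) \<in> H1 \<Omega>"
    using H1_add[OF \<Omega> H10_H1[OF v] H1_scale[OF test_function_H1[OF \<Omega> f(1)], of "-1"]] by simp
  have "\<bar>c\<bar> * H1_norm \<Omega> (\<lambda>x. v x - f x) \<le> (\<bar>c\<bar> + 1) * H1_norm \<Omega> (\<lambda>x. v x - f x)"
    using H1_norm_nonneg[OF d] by (intro mult_right_mono) auto
  also have "\<dots> < e" using f(2) by (simp add: pos_less_divide_eq mult.commute)
  finally have "H1_norm \<Omega> (\<lambda>x. c * (v x - f x)) < e" using H1_norm_scale[OF d, of c] by simp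
  then show "\<exists>\<phi>\<in>test_functions \<Omega>. H1_norm \<Omega> (\<lambda>x. c * v x - \<phi> x) < e"
    by (intro bexI[OF _ test_functions_scale[OF f(1), of c]]) (simp add: algebra_simps)
qed

lemma H10_diff:
  assumes "open \<Omega>" "v \<in> H10 \<Omega>" "w \<in> H10 \<Omega>"
  shows "(\<lambda>x. v x - w x) \<in> H10 \<Omega>"
  using H10_add[OF assms(1,2) H10_scale[OF assms(1,3), of "-1"]] by simp

lemma H10_norm_nonneg: "v \<in> H10 \<Omega> \<Longrightarrow> 0 \<le> H1_norm \<Omega> v"
  by (rule H1_norm_nonneg[OF H10_H1])

lemma H10_norm_scale: "v \<in> H10 \<Omega> \<Longrightarrow> H1_norm \<Omega> (\<lambda>x. c * v x) = \<bar>c\<bar> * H1_norm \<Omega> v"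
  by (rule H1_norm_scale[OF H10_H1])

section \<open>Norms of functionals and operators\<close>

lemma Hm1D:
  assumes "L \<in> Hm1 \<Omega>"
  shows "v \<in> H10 \<Omega> \<Longrightarrow> w \<in> H10 \<Omega> \<Longrightarrow> L (\<lambda>x. v x + w x) = L v + L w"
    and "v \<in> H10 \<Omega> \<Longrightarrow> L (\<lambda>x. c * v x) = c * L v"
  using assms by (auto simp: Hm1_def)

lemma Hm1_bounded:
  assumes "L \<in> Hm1 \<Omega>"
  obtains C where "\<And>v. v \<in> H10 \<Omega> \<Longrightarrow> \<bar>L v\<bar> \<le> C * H1_norm \<Omega> v"
  using assms unfolding Hm1_def by blast

lemma Hm1_combine:
  assumes "L \<in> Hm1 \<Omega>" "M \<in> Hm1 \<Omega>"
  shows "(\<lambda>v. L v + c * M v) \<in> Hm1 \<Omega>"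
proof -
  obtain B where B: "\<And>v. v \<in> H10 \<Omega> \<Longrightarrow> \<bar>L v\<bar> \<le> B * H1_norm \<Omega> v"
    using Hm1_bounded[OF assms(1)] by blast
  obtain C where C: "\<And>v. v \<in> H10 \<Omega> \<Longrightarrow> \<bar>M v\<bar> \<le> C * H1_norm \<Omega> v"
    using Hm1_bounded[OF assms(2)] by blast
  have "\<bar>L v + c * M v\<bar> \<le> (B + \<bar>c\<bar> * C) * H1_norm \<Omega> v" if v: "v \<in> H10 \<Omega>" for v
  proof -
    have "\<bar>L v + c * M v\<bar> \<le> \<bar>L v\<bar> + \<bar>c\<bar> * \<bar>M v\<bar>"
      by (metis abs_mult abs_triangle_ineq)
    also have "\<dots> \<le> B * H1_norm \<Omega> v + \<bar>c\<bar> * (C * H1_norm \<Omega> v)"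
      using B[OF v] C[OF v] by (intro add_mono mult_left_mono) auto
    finally show ?thesis by (simp add: algebra_simps)
  qed
  then have "\<exists>D. \<forall>v\<in>H10 \<Omega>. \<bar>L v + c * M v\<bar> \<le> D * H1_norm \<Omega> v" by blast
  then show ?thesis
    using assms unfolding Hm1_def by (simp add: distrib_left mult.left_commute)
qed

lemma Hm1_norm_upper:
  assumes L: "L \<in> Hm1 \<Omega>" and v: "v \<in> H10 \<Omega>" "H1_norm \<Omega> v \<le> 1"
  shows "\<bar>L v\<bar> \<le> Hm1_norm \<Omega> L"
  unfolding Hm1_norm_def
proof (rule cSUP_upper)
  obtain C where C: "\<And>v. v \<in> H10 \<Omega> \<Longrightarrow> \<bar>L v\<bar> \<le> C * H1_norm \<Omega> v"
    using Hm1_bounded[OF L] by blast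
  have "\<bar>L w\<bar> \<le> \<bar>C\<bar>" if "w \<in> H10 \<Omega>" "H1_norm \<Omega> w \<le> 1" for w
  proof -
    have "C * H1_norm \<Omega> w \<le> \<bar>C\<bar> * H1_norm \<Omega> w"
      using H10_norm_nonneg[OF that(1)] by (intro mult_right_mono) auto
    also have "\<dots> \<le> \<bar>C\<bar> * 1" using that(2) by (intro mult_left_mono) auto
    finally show ?thesis using C[OF that(1)] by simp
  qed
  then show "bdd_above ((\<lambda>w. \<bar>L w\<bar>) ` {w \<in> H10 \<Omega>. H1_norm \<Omega> w \<le> 1})"
    by (auto intro!: bdd_aboveI[of _ "\<bar>C\<bar>"])
qed (use v in auto)

text \<open>
  Normalise \<open>v\<close>.  A nonzero function may have norm zero, since only a seminorm is given; then the
  boundedness of \<open>L\<close> forces \<open>L v = 0\<close>.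
\<close>

lemma Hm1_norm_bound:
  assumes \<Omega>: "open \<Omega>" and L: "L \<in> Hm1 \<Omega>" and v: "v \<in> H10 \<Omega>"
  shows "\<bar>L v\<bar> \<le> Hm1_norm \<Omega> L * H1_norm \<Omega> v"
proof (cases "H1_norm \<Omega> v = 0")
  case True
  obtain C where "\<And>v. v \<in> H10 \<Omega> \<Longrightarrow> \<bar>L v\<bar> \<le> C * H1_norm \<Omega> v"
    using Hm1_bounded[OF L] by blast
  from this[OF v] True show ?thesis by simp
next
  case False
  define t where "t = 1 / H1_norm \<Omega> v"
  have t: "0 < t" "t * H1_norm \<Omega> v = 1"
    using False H10_norm_nonneg[OF v] by (auto simp: t_def)
  have "\<bar>L (\<lambda>x. t * v x)\<bar> \<le> Hm1_norm \<Omega> L"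
    using H10_scale[OF \<Omega> v] H10_norm_scale[OF v, of t] t by (intro Hm1_norm_upper[OF L]) auto
  then have "t * \<bar>L v\<bar> \<le> Hm1_norm \<Omega> L"
    using Hm1D(2)[OF L v] t by (simp add: abs_mult)
  then show ?thesis using False H10_norm_nonneg[OF v] by (simp add: t_def field_simps)
qed

lemma H10_unit_ball_nonempty: "{v \<in> H10 \<Omega>. H1_norm \<Omega> v \<le> 1} \<noteq> {}"
proof -
  have "(\<lambda>x. 0) \<in> {v \<in> H10 \<Omega>. H1_norm \<Omega> v \<le> 1}"
    using H10_zero[of \<Omega>] H1_norm_zero[of \<Omega>] by simp
  then show ?thesis by blast
qed

lemma Hm1_norm_le:
  assumes "0 \<le> C" "\<And>v. v \<in> H10 \<Omega> \<Longrightarrow> \<bar>L v\<bar> \<le> C * H1_norm \<Omega> v"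
  shows "Hm1_norm \<Omega> L \<le> C"
  unfolding Hm1_norm_def
proof (rule cSUP_least[OF H10_unit_ball_nonempty])
  fix v assume "v \<in> {v \<in> H10 \<Omega>. H1_norm \<Omega> v \<le> 1}"
  then show "\<bar>L v\<bar> \<le> C"
    using assms(2)[of v] mult_left_mono[of "H1_norm \<Omega> v" 1 C] assms(1) by auto
qed

lemma Hm1_norm_nonneg:
  assumes "L \<in> Hm1 \<Omega>"
  shows "0 \<le> Hm1_norm \<Omega> L"
  using Hm1_norm_upper[OF assms H10_zero] by (simp add: H1_norm_zero)

lemma bounded_operatorsD:
  assumes "T \<in> bounded_operators \<Omega>"
  shows "w \<in> H10 \<Omega> \<Longrightarrow> T w \<in> Hm1 \<Omega>"
    and "w \<in> H10 \<Omega> \<Longrightarrow> z \<in> H10 \<Omega> \<Longrightarrow> v \<in> H10 \<Omega> \<Longrightarrow> T (\<lambda>x. w x + z x) v = T w v + T z v"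
    and "w \<in> H10 \<Omega> \<Longrightarrow> v \<in> H10 \<Omega> \<Longrightarrow> T (\<lambda>x. c * w x) v = c * T w v"
  using assms by (auto simp: bounded_operators_def)

text \<open>
  A bounded operator into the dual space is the same thing as a bounded bilinear form; with
  \<open>bounded_operatorsI\<close> below, this allows operators to be handled through the numbers \<open>T w v\<close>.
\<close>

lemma bounded_operators_bounded:
  assumes \<Omega>: "open \<Omega>" and T: "T \<in> bounded_operators \<Omega>"
  obtains C where "C \<ge> 0"
    "\<And>w v. w \<in> H10 \<Omega> \<Longrightarrow> v \<in> H10 \<Omega> \<Longrightarrow> \<bar>T w v\<bar> \<le> C * H1_norm \<Omega> w * H1_norm \<Omega> v"
proof -
  obtain C where C: "\<And>w. w \<in> H10 \<Omega> \<Longrightarrow> Hm1_norm \<Omega> (T w) \<le> C * H1_norm \<Omega> w"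
    using T unfolding bounded_operators_def by blast
  have "\<bar>T w v\<bar> \<le> \<bar>C\<bar> * H1_norm \<Omega> w * H1_norm \<Omega> v" if w: "w \<in> H10 \<Omega>" and v: "v \<in> H10 \<Omega>" for w v
  proof -
    have "C * H1_norm \<Omega> w \<le> \<bar>C\<bar> * H1_norm \<Omega> w"
      using H10_norm_nonneg[OF w] by (intro mult_right_mono) auto
    with C[OF w] have "Hm1_norm \<Omega> (T w) \<le> \<bar>C\<bar> * H1_norm \<Omega> w" by linarith
    then have "Hm1_norm \<Omega> (T w) * H1_norm \<Omega> v \<le> \<bar>C\<bar> * H1_norm \<Omega> w * H1_norm \<Omega> v"
      using H10_norm_nonneg[OF v] by (rule mult_right_mono)
    then show ?thesis
      using Hm1_norm_bound[OF \<Omega> bounded_operatorsD(1)[OF T w] v] by linarith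
  qed
  then show ?thesis using that[of "\<bar>C\<bar>"] by simp
qed

lemma bounded_operatorsI:
  assumes "\<And>w v z. w \<in> H10 \<Omega> \<Longrightarrow> v \<in> H10 \<Omega> \<Longrightarrow> z \<in> H10 \<Omega> \<Longrightarrow> T w (\<lambda>x. v x + z x) = T w v + T w z"
    and "\<And>w c v. w \<in> H10 \<Omega> \<Longrightarrow> v \<in> H10 \<Omega> \<Longrightarrow> T w (\<lambda>x. c * v x) = c * T w v"
    and "\<And>w z v. w \<in> H10 \<Omega> \<Longrightarrow> z \<in> H10 \<Omega> \<Longrightarrow> v \<in> H10 \<Omega> \<Longrightarrow> T (\<lambda>x. w x + z x) v = T w v + T z v"
    and "\<And>w c v. w \<in> H10 \<Omega> \<Longrightarrow> v \<in> H10 \<Omega> \<Longrightarrow> T (\<lambda>x. c * w x) v = c * T w v"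
    and C: "C \<ge> 0" "\<And>w v. w \<in> H10 \<Omega> \<Longrightarrow> v \<in> H10 \<Omega> \<Longrightarrow> \<bar>T w v\<bar> \<le> C * H1_norm \<Omega> w * H1_norm \<Omega> v"
  shows "T \<in> bounded_operators \<Omega>"
proof -
  have "T w \<in> Hm1 \<Omega>" if "w \<in> H10 \<Omega>" for w
    unfolding Hm1_def using assms(1,2) C that
    by (auto intro!: exI[of _ "C * H1_norm \<Omega> w"])
  moreover have "Hm1_norm \<Omega> (T w) \<le> C * H1_norm \<Omega> w" if "w \<in> H10 \<Omega>" for w
    using C that H10_norm_nonneg[OF that] by (intro Hm1_norm_le) auto
  ultimately show ?thesis
    unfolding bounded_operators_def using assms(3,4) by (auto intro!: exI[of _ C])
qed

lemma bounded_operators_combine: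
  assumes \<Omega>: "open \<Omega>" and S: "S \<in> bounded_operators \<Omega>" and T: "T \<in> bounded_operators \<Omega>"
  shows "(\<lambda>w v. S w v + c * T w v) \<in> bounded_operators \<Omega>"
proof -
  obtain B where B: "B \<ge> 0"
    "\<And>w v. w \<in> H10 \<Omega> \<Longrightarrow> v \<in> H10 \<Omega> \<Longrightarrow> \<bar>S w v\<bar> \<le> B * H1_norm \<Omega> w * H1_norm \<Omega> v"
    using bounded_operators_bounded[OF \<Omega> S] by blast
  obtain C where C: "C \<ge> 0"
    "\<And>w v. w \<in> H10 \<Omega> \<Longrightarrow> v \<in> H10 \<Omega> \<Longrightarrow> \<bar>T w v\<bar> \<le> C * H1_norm \<Omega> w * H1_norm \<Omega> v"
    using bounded_operators_bounded[OF \<Omega> T] by blast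
  note lin = bounded_operatorsD[OF S] bounded_operatorsD[OF T]
    Hm1D[OF bounded_operatorsD(1)[OF S]] Hm1D[OF bounded_operatorsD(1)[OF T]]
  show ?thesis
  proof (rule bounded_operatorsI[where C = "B + \<bar>c\<bar> * C"])
    fix w v assume w: "w \<in> H10 \<Omega>" and v: "v \<in> H10 \<Omega>"
    have "\<bar>S w v + c * T w v\<bar> \<le> \<bar>S w v\<bar> + \<bar>c\<bar> * \<bar>T w v\<bar>"
      by (metis abs_mult abs_triangle_ineq)
    also have "\<dots> \<le> B * H1_norm \<Omega> w * H1_norm \<Omega> v + \<bar>c\<bar> * (C * H1_norm \<Omega> w * H1_norm \<Omega> v)"
      using B(2)[OF w v] C(2)[OF w v] by (intro add_mono mult_left_mono) auto
    finally show "\<bar>S w v + c * T w v\<bar> \<le> (B + \<bar>c\<bar> * C) * H1_norm \<Omega> w * H1_norm \<Omega> v"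
      by (simp add: algebra_simps)
  qed (use B C in \<open>simp_all add: lin distrib_left mult.left_commute\<close>)
qed

lemma bounded_operators_diff:
  assumes "open \<Omega>" "S \<in> bounded_operators \<Omega>" "T \<in> bounded_operators \<Omega>"
  shows "(\<lambda>w v. S w v - T w v) \<in> bounded_operators \<Omega>"
  using bounded_operators_combine[OF assms, of "-1"] by simp

lemma bounded_operators_sum:
  assumes \<Omega>: "open \<Omega>" and T: "\<And>i. i \<in> I \<Longrightarrow> T i \<in> bounded_operators \<Omega>"
  shows "(\<lambda>w v. \<Sum>i\<in>I. c i * T i w v) \<in> bounded_operators \<Omega>"
proof -
  have z: "(\<lambda>w v. 0) \<in> bounded_operators \<Omega>"
    by (rule bounded_operatorsI[where C = 0]) auto
  show ?thesis
    using T
  proof (induction I rule: infinite_finite_induct)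
    case (insert i I)
    then have "(\<lambda>w v. (\<Sum>i\<in>I. c i * T i w v) + c i * T i w v) \<in> bounded_operators \<Omega>"
      by (intro bounded_operators_combine[OF \<Omega>]) auto
    then show ?case using insert by (simp add: add.commute)
  qed (use z in auto)
qed

lemma op_norm_upper:
  assumes \<Omega>: "open \<Omega>" and T: "T \<in> bounded_operators \<Omega>"
    and w: "w \<in> H10 \<Omega>" "H1_norm \<Omega> w \<le> 1"
  shows "Hm1_norm \<Omega> (T w) \<le> op_norm \<Omega> T"
  unfolding op_norm_def
proof (rule cSUP_upper)
  obtain C where C: "C \<ge> 0" "\<And>w v. w \<in> H10 \<Omega> \<Longrightarrow> v \<in> H10 \<Omega> \<Longrightarrow> \<bar>T w v\<bar> \<le> C * H1_norm \<Omega> w * H1_norm \<Omega> v"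
    using bounded_operators_bounded[OF \<Omega> T] by blast
  have "Hm1_norm \<Omega> (T z) \<le> C" if "z \<in> H10 \<Omega>" "H1_norm \<Omega> z \<le> 1" for z
  proof -
    have "Hm1_norm \<Omega> (T z) \<le> C * H1_norm \<Omega> z"
      using C that H10_norm_nonneg[OF that(1)] by (intro Hm1_norm_le) auto
    also have "\<dots> \<le> C * 1" using that C by (intro mult_left_mono) auto
    finally show ?thesis by simp
  qed
  then show "bdd_above ((\<lambda>z. Hm1_norm \<Omega> (T z)) ` {z \<in> H10 \<Omega>. H1_norm \<Omega> z \<le> 1})"
    by (auto intro!: bdd_aboveI[of _ C])
qed (use w in auto)

text \<open>
  As for functionals, normalise \<open>w\<close>, with a separate argument for \<open>w\<close> of norm zero.
\<close>

lemma op_norm_bound: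
  assumes \<Omega>: "open \<Omega>" and T: "T \<in> bounded_operators \<Omega>" and w: "w \<in> H10 \<Omega>" and v: "v \<in> H10 \<Omega>"
  shows "\<bar>T w v\<bar> \<le> op_norm \<Omega> T * H1_norm \<Omega> w * H1_norm \<Omega> v"
proof (cases "H1_norm \<Omega> w = 0")
  case True
  obtain C where C: "C \<ge> 0"
    "\<And>w v. w \<in> H10 \<Omega> \<Longrightarrow> v \<in> H10 \<Omega> \<Longrightarrow> \<bar>T w v\<bar> \<le> C * H1_norm \<Omega> w * H1_norm \<Omega> v"
    using bounded_operators_bounded[OF \<Omega> T] by blast
  from C(2)[OF w v] True show ?thesis by simp
next
  case False
  define t where "t = 1 / H1_norm \<Omega> w"
  have t: "0 < t" "t * H1_norm \<Omega> w = 1"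
    using False H10_norm_nonneg[OF w] by (auto simp: t_def)
  have tw: "(\<lambda>x. t * w x) \<in> H10 \<Omega>" "H1_norm \<Omega> (\<lambda>x. t * w x) \<le> 1"
    using H10_scale[OF \<Omega> w] H10_norm_scale[OF w, of t] t by auto
  have "Hm1_norm \<Omega> (T (\<lambda>x. t * w x)) * H1_norm \<Omega> v \<le> op_norm \<Omega> T * H1_norm \<Omega> v"
    using op_norm_upper[OF \<Omega> T tw] H10_norm_nonneg[OF v] by (rule mult_right_mono)
  moreover have "T (\<lambda>x. t * w x) \<in> Hm1 \<Omega>" using T tw by (simp add: bounded_operators_def)
  from Hm1_norm_bound[OF \<Omega> this v]
  have "\<bar>T (\<lambda>x. t * w x) v\<bar> \<le> Hm1_norm \<Omega> (T (\<lambda>x. t * w x)) * H1_norm \<Omega> v" .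
  moreover have "T (\<lambda>x. t * w x) v = t * T w v"
    by (rule bounded_operatorsD(3)[OF T w v])
  ultimately have "t * \<bar>T w v\<bar> \<le> op_norm \<Omega> T * H1_norm \<Omega> v"
    using t(1) by (simp add: abs_mult)
  then show ?thesis using False H10_norm_nonneg[OF w] by (simp add: t_def field_simps)
qed

lemma op_norm_le:
  assumes "0 \<le> C"
    and "\<And>w v. w \<in> H10 \<Omega> \<Longrightarrow> v \<in> H10 \<Omega> \<Longrightarrow> \<bar>T w v\<bar> \<le> C * H1_norm \<Omega> w * H1_norm \<Omega> v"
  shows "op_norm \<Omega> T \<le> C"
  unfolding op_norm_def
proof (rule cSUP_least[OF H10_unit_ball_nonempty])
  fix w assume "w \<in> {w \<in> H10 \<Omega>. H1_norm \<Omega> w \<le> 1}"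
  then have w: "w \<in> H10 \<Omega>" "H1_norm \<Omega> w \<le> 1" by auto
  have "Hm1_norm \<Omega> (T w) \<le> C * H1_norm \<Omega> w"
    using assms w H10_norm_nonneg[OF w(1)] by (intro Hm1_norm_le) auto
  also have "\<dots> \<le> C * 1" using w assms(1) by (intro mult_left_mono) auto
  finally show "Hm1_norm \<Omega> (T w) \<le> C" by simp
qed

lemma op_norm_nonneg:
  assumes \<Omega>: "open \<Omega>" and T: "T \<in> bounded_operators \<Omega>"
  shows "0 \<le> op_norm \<Omega> T"
proof -
  have "0 \<le> Hm1_norm \<Omega> (T (\<lambda>x. 0))"
    using T H10_zero by (intro Hm1_norm_nonneg) (auto simp: bounded_operators_def)
  also have "\<dots> \<le> op_norm \<Omega> T"
    by (rule op_norm_upper[OF \<Omega> T H10_zero]) (simp add: H1_norm_zero)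
  finally show ?thesis .
qed

section \<open>Integrals of continuous operator families\<close>

lemma tagged_division_sum_bounded_operator:
  assumes \<Omega>: "open \<Omega>" and T: "\<And>\<xi>. \<xi> \<in> {0..1} \<Longrightarrow> T \<xi> \<in> bounded_operators \<Omega>"
    and p: "p tagged_division_of {0..1::real}"
  shows "(\<lambda>w v. \<Sum>(\<xi>,K)\<in>p. measure lborel K * T \<xi> w v) \<in> bounded_operators \<Omega>"
proof -
  have "(\<lambda>w v. \<Sum>i\<in>p. measure lborel (snd i) * T (fst i) w v) \<in> bounded_operators \<Omega>"
  proof (rule bounded_operators_sum[OF \<Omega>])
    fix i assume i: "i \<in> p"
    obtain \<xi> K where iK: "i = (\<xi>, K)" by force
    then have "\<xi> \<in> K" "K \<subseteq> {0..1}" using tagged_division_ofD(2,3)[OF p] i by auto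
    then show "T (fst i) \<in> bounded_operators \<Omega>" using iK T by auto
  qed
  then show ?thesis by (simp add: case_prod_unfold)
qed

text \<open>
  The integral is built weakly and then shown to be a limit in operator norm.  For fixed \<open>w\<close> and \<open>v\<close> the
  function \<open>T \<xi> w v\<close> of \<open>\<xi>\<close> is continuous, and \<open>A w v\<close> is its integral.  Around each tag \<open>\<xi>\<close> choose a
  radius within which \<open>T\<close> varies by less than \<open>e\<close> in operator norm.  This gauge does not depend on
  \<open>w\<close> and \<open>v\<close>, and on a tagged division finer than it the Riemann sum differs from \<open>A w v\<close> by at
  most \<open>e\<close> times the norms of \<open>w\<close> and \<open>v\<close>.  That estimate gives convergence, and a single division with
  \<open>e = 1\<close> already shows that \<open>A\<close> is bounded.
\<close>

lemma has_op_integral_of_continuous: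
  assumes \<Omega>: "open \<Omega>"
    and T: "\<And>\<xi>. \<xi> \<in> {0..1} \<Longrightarrow> T \<xi> \<in> bounded_operators \<Omega>"
    and cont: "\<And>\<xi> e. \<xi> \<in> {0..1} \<Longrightarrow> e > 0 \<Longrightarrow>
      \<exists>d>0. \<forall>\<eta>\<in>{0..1}. \<bar>\<eta> - \<xi>\<bar> < d \<longrightarrow> op_norm \<Omega> (\<lambda>w v. T \<eta> w v - T \<xi> w v) < e"
  shows "\<exists>A. has_op_integral \<Omega> T A"
proof -
  define A where "A w v = integral {0..1} (\<lambda>\<xi>. T \<xi> w v)" for w v
  have close: "\<bar>T \<eta> w v - T \<xi> w v\<bar> \<le> e * (H1_norm \<Omega> w * H1_norm \<Omega> v)"
    if "op_norm \<Omega> (\<lambda>w v. T \<eta> w v - T \<xi> w v) < e" "\<eta> \<in> {0..1}" "\<xi> \<in> {0..1}"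
      and wv: "w \<in> H10 \<Omega>" "v \<in> H10 \<Omega>" for \<eta> \<xi> e w v
  proof -
    have "\<bar>T \<eta> w v - T \<xi> w v\<bar>
        \<le> op_norm \<Omega> (\<lambda>w v. T \<eta> w v - T \<xi> w v) * (H1_norm \<Omega> w * H1_norm \<Omega> v)"
      using op_norm_bound[OF \<Omega> bounded_operators_diff[OF \<Omega> T T] wv] that by (simp add: mult.assoc)
    also have "\<dots> \<le> e * (H1_norm \<Omega> w * H1_norm \<Omega> v)"
      using that H10_norm_nonneg[OF wv(1)] H10_norm_nonneg[OF wv(2)]
      by (intro mult_right_mono mult_nonneg_nonneg) auto
    finally show ?thesis .
  qed
  have int: "(\<lambda>\<xi>. T \<xi> w v) integrable_on {0..1}" if wv: "w \<in> H10 \<Omega>" "v \<in> H10 \<Omega>" for w v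
  proof (rule integrable_continuous_real)
    define M where "M = H1_norm \<Omega> w * H1_norm \<Omega> v"
    have M: "0 \<le> M" unfolding M_def using wv by (intro mult_nonneg_nonneg H10_norm_nonneg)
    show "continuous_on {0..1} (\<lambda>\<xi>. T \<xi> w v)"
      unfolding continuous_on_iff dist_real_def
    proof (intro ballI allI impI)
      fix \<xi> e :: real assume \<xi>: "\<xi> \<in> {0..1}" and e: "0 < e"
      then have "0 < e / (M + 1)" using M by simp
      from cont[OF \<xi> this] obtain d where d: "d > 0" "\<And>\<eta>. \<eta> \<in> {0..1} \<Longrightarrow> \<bar>\<eta> - \<xi>\<bar> < d \<Longrightarrow>
          op_norm \<Omega> (\<lambda>w v. T \<eta> w v - T \<xi> w v) < e / (M + 1)" by blast
      have "\<bar>T \<eta> w v - T \<xi> w v\<bar> < e" if "\<eta> \<in> {0..1}" "\<bar>\<eta> - \<xi>\<bar> < d" for \<eta>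
      proof -
        have "\<bar>T \<eta> w v - T \<xi> w v\<bar> \<le> e / (M + 1) * M"
          unfolding M_def[symmetric] using close[OF d(2)[OF that] that(1) \<xi> wv] by (simp add: M_def)
        also have "\<dots> < e" using M e by (simp add: field_simps)
        finally show ?thesis .
      qed
      then show "\<exists>d>0. \<forall>\<eta>\<in>{0..1}. \<bar>\<eta> - \<xi>\<bar> < d \<longrightarrow> \<bar>T \<eta> w v - T \<xi> w v\<bar> < e" using d(1) by blast
    qed
  qed
  define approx where "approx e p \<longleftrightarrow> (\<forall>w\<in>H10 \<Omega>. \<forall>v\<in>H10 \<Omega>.
      \<bar>(\<Sum>(\<xi>,K)\<in>p. measure lborel K * T \<xi> w v) - A w v\<bar> \<le> e * H1_norm \<Omega> w * H1_norm \<Omega> v)"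
    for e and p :: "(real \<times> real set) set"
  have riemann: "\<exists>\<gamma>. gauge \<gamma> \<and> (\<forall>p. p tagged_division_of {0..1} \<and> \<gamma> fine p \<longrightarrow> approx e p)"
    if e: "e > 0" for e :: real
  proof -
    define near where "near \<xi> r \<longleftrightarrow> (\<forall>\<eta>\<in>{0..1}. \<bar>\<eta> - \<xi>\<bar> < r \<longrightarrow>
        op_norm \<Omega> (\<lambda>w v. T \<eta> w v - T \<xi> w v) < e)" for \<xi> r
    have "\<exists>r. 0 < r \<and> (\<xi> \<in> {0..1} \<longrightarrow> near \<xi> r)" for \<xi>
    proof (cases "\<xi> \<in> {0..1}")
      case True
      from cont[OF this e] show ?thesis by (auto simp: near_def)
    next
      case False
      then show ?thesis using zero_less_one by blast
    qed
    then obtain d where d0: "\<And>\<xi>. d \<xi> > 0" "\<And>\<xi>. \<xi> \<in> {0..1} \<Longrightarrow> near \<xi> (d \<xi>)"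
      by metis
    have d: "op_norm \<Omega> (\<lambda>w v. T \<eta> w v - T \<xi> w v) < e"
      if "\<xi> \<in> {0..1}" "\<eta> \<in> {0..1}" "\<bar>\<eta> - \<xi>\<bar> < d \<xi>" for \<xi> \<eta>
      using d0(2)[OF that(1)] that(2,3) by (simp add: near_def)
    define \<gamma> where "\<gamma> \<xi> = ball \<xi> (d \<xi>)" for \<xi>
    have "gauge \<gamma>" using d0(1) by (auto simp: gauge_def \<gamma>_def)
    moreover have "\<bar>(\<Sum>(\<xi>,K)\<in>p. measure lborel K * T \<xi> w v) - A w v\<bar> \<le> e * H1_norm \<Omega> w * H1_norm \<Omega> v"
      if p: "p tagged_division_of {0..1}" "\<gamma> fine p" and wv: "w \<in> H10 \<Omega>" "v \<in> H10 \<Omega>" for p w v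
    proof -
      define M where "M = H1_norm \<Omega> w * H1_norm \<Omega> v"
      have M: "0 \<le> M" unfolding M_def using wv by (intro mult_nonneg_nonneg H10_norm_nonneg)
      define f where "f \<xi> = T \<xi> w v" for \<xi>
      have "A w v = (\<Sum>(\<xi>,K)\<in>p. integral K f)"
        unfolding A_def f_def using int[OF wv] p(1)
        by (metis integral_combine_tagged_division_topdown interval_cbox)
      then have "(\<Sum>(\<xi>,K)\<in>p. measure lborel K * T \<xi> w v) - A w v
          = (\<Sum>i\<in>p. measure lborel (snd i) * f (fst i) - integral (snd i) f)"
        by (simp add: case_prod_unfold f_def sum_subtractf)
      also have "\<bar>\<dots>\<bar> \<le> (\<Sum>i\<in>p. e * M * measure lborel (snd i))"
      proof (rule order_trans[OF sum_abs sum_mono])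
        fix i assume i: "i \<in> p"
        obtain \<xi> K where iK: "i = (\<xi>, K)" by force
        obtain a b where K: "K = cbox a b" using tagged_division_ofD(4)[OF p(1)] i iK by blast
        have \<xi>: "\<xi> \<in> K" "K \<subseteq> {0..1}" using tagged_division_ofD(2,3)[OF p(1)] i iK by auto
        have Kd: "K \<subseteq> ball \<xi> (d \<xi>)" using p(2) i iK by (auto simp: fine_def \<gamma>_def)
        have fK: "f integrable_on K"
          using int[OF wv] \<xi>(2) unfolding f_def K by (metis integrable_on_subcbox interval_cbox)
        have "((\<lambda>\<eta>. f \<xi> - f \<eta>) has_integral (measure lborel K * f \<xi> - integral K f)) K"
          using has_integral_diff[OF has_integral_const[of "f \<xi>" a b] integrable_integral[OF fK[unfolded K]]]
          unfolding K by simp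
        then have "norm (measure lborel K * f \<xi> - integral K f) \<le> (e * M) * measure lborel K"
          unfolding K
        proof (rule has_integral_bound[rotated])
          show "0 \<le> e * M" using e M by simp
          fix \<eta> assume "\<eta> \<in> cbox a b"
          then have \<eta>: "\<eta> \<in> {0..1}" "\<bar>\<eta> - \<xi>\<bar> < d \<xi>"
            using \<xi> Kd K by (auto simp: dist_real_def abs_minus_commute subset_iff)
          have \<xi>1: "\<xi> \<in> {0..1}" using \<xi> by auto
          from close[OF d[OF \<xi>1 \<eta>] \<eta>(1) \<xi>1 wv]
          show "norm (f \<xi> - f \<eta>) \<le> e * M" by (simp add: f_def M_def abs_minus_commute)
        qed
        then show "\<bar>measure lborel (snd i) * f (fst i) - integral (snd i) f\<bar> \<le> e * M * measure lborel (snd i)"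
          using iK by simp
      qed
      \<comment> \<open>The pieces of a division of the unit interval have total length 1.\<close>
      also have "\<dots> = e * M"
        using additive_content_tagged_division[of p 0 "1::real"] p(1)
        by (simp add: sum_distrib_left[symmetric] case_prod_unfold)
      finally show ?thesis by (simp add: M_def mult.assoc)
    qed
    ultimately show ?thesis unfolding approx_def by (intro exI[of _ \<gamma>]) simp
  qed
  have A: "A \<in> bounded_operators \<Omega>"
  proof -
    obtain \<gamma> where \<gamma>: "gauge \<gamma>" "\<And>p. p tagged_division_of {0..1} \<Longrightarrow> \<gamma> fine p \<Longrightarrow> approx 1 p"
      using riemann[OF zero_less_one] by (elim exE conjE) simp
    obtain p where p: "p tagged_division_of {0..1}" "\<gamma> fine p"
      using fine_division_exists_real[OF \<gamma>(1)] by blast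
    have S: "(\<lambda>w v. \<Sum>(\<xi>,K)\<in>p. measure lborel K * T \<xi> w v) \<in> bounded_operators \<Omega>"
      using T by (rule tagged_division_sum_bounded_operator[OF \<Omega> _ p(1)])
    obtain C where C: "C \<ge> 0" "\<And>w v. w \<in> H10 \<Omega> \<Longrightarrow> v \<in> H10 \<Omega> \<Longrightarrow>
        \<bar>\<Sum>(\<xi>,K)\<in>p. measure lborel K * T \<xi> w v\<bar> \<le> C * H1_norm \<Omega> w * H1_norm \<Omega> v"
      using bounded_operators_bounded[OF \<Omega> S] by blast
    note TD = bounded_operatorsD[OF T] Hm1D[OF bounded_operatorsD(1)[OF T]]
    show ?thesis
    proof (rule bounded_operatorsI[where C = "C + 1"])
      fix w v assume w: "w \<in> H10 \<Omega>" and v: "v \<in> H10 \<Omega>"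
      show "\<bar>A w v\<bar> \<le> (C + 1) * H1_norm \<Omega> w * H1_norm \<Omega> v"
      proof -
        have "\<bar>(\<Sum>(\<xi>,K)\<in>p. measure lborel K * T \<xi> w v) - A w v\<bar> \<le> 1 * H1_norm \<Omega> w * H1_norm \<Omega> v"
          using \<gamma>(2)[OF p] w v by (simp add: approx_def)
        with C(2)[OF w v] show ?thesis unfolding distrib_right by linarith
      qed
      show "A w (\<lambda>x. c * v x) = c * A w v" for c
      proof -
        have "A w (\<lambda>x. c * v x) = integral {0..1} (\<lambda>\<xi>. c * T \<xi> w v)"
          unfolding A_def using TD w v by (intro integral_cong) auto
        then show ?thesis by (simp add: A_def)
      qed
      show "A (\<lambda>x. c * w x) v = c * A w v" for c
      proof -
        have "A (\<lambda>x. c * w x) v = integral {0..1} (\<lambda>\<xi>. c * T \<xi> w v)"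
          unfolding A_def using TD w v by (intro integral_cong) auto
        then show ?thesis by (simp add: A_def)
      qed
      fix z assume z: "z \<in> H10 \<Omega>"
      have "A w (\<lambda>x. v x + z x) = integral {0..1} (\<lambda>\<xi>. T \<xi> w v + T \<xi> w z)"
        unfolding A_def using TD w v z by (intro integral_cong) auto
      then show "A w (\<lambda>x. v x + z x) = A w v + A w z"
        unfolding A_def by (simp add: Henstock_Kurzweil_Integration.integral_add int w v z)
      have "A (\<lambda>x. v x + z x) w = integral {0..1} (\<lambda>\<xi>. T \<xi> v w + T \<xi> z w)"
        unfolding A_def using TD w v z by (intro integral_cong) auto
      then show "A (\<lambda>x. v x + z x) w = A v w + A z w"
        unfolding A_def by (simp add: Henstock_Kurzweil_Integration.integral_add int w v z)
    qed (use C in auto)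
  qed
  have "((\<lambda>p. op_norm \<Omega> (\<lambda>w v. (\<Sum>(\<xi>,K)\<in>p. measure lborel K * T \<xi> w v) - A w v)) \<longlongrightarrow> 0)
      (division_filter {0..1})"
  proof (rule tendstoI)
    fix e :: real assume "e > 0"
    then have e: "e / 2 > 0" by simp
    obtain \<gamma> where \<gamma>: "gauge \<gamma>" "\<And>p. p tagged_division_of {0..1} \<Longrightarrow> \<gamma> fine p \<Longrightarrow> approx (e/2) p"
      using riemann[OF e] by (elim exE conjE) simp
    have "dist (op_norm \<Omega> (\<lambda>w v. (\<Sum>(\<xi>,K)\<in>p. measure lborel K * T \<xi> w v) - A w v)) 0 < e"
      if p: "p tagged_division_of {0..1}" "\<gamma> fine p" for p
    proof -
      have "op_norm \<Omega> (\<lambda>w v. (\<Sum>(\<xi>,K)\<in>p. measure lborel K * T \<xi> w v) - A w v) \<le> e/2"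
        using e \<gamma>(2)[OF p] by (intro op_norm_le) (auto simp: approx_def)
      moreover have "0 \<le> op_norm \<Omega> (\<lambda>w v. (\<Sum>(\<xi>,K)\<in>p. measure lborel K * T \<xi> w v) - A w v)"
        by (intro op_norm_nonneg[OF \<Omega>] bounded_operators_diff[OF \<Omega>]
            tagged_division_sum_bounded_operator[OF \<Omega> T p(1)] A)
      ultimately show ?thesis using e by simp
    qed
    then show "\<forall>\<^sub>F p in division_filter {0..1}.
        dist (op_norm \<Omega> (\<lambda>w v. (\<Sum>(\<xi>,K)\<in>p. measure lborel K * T \<xi> w v) - A w v)) 0 < e"
      unfolding eventually_division_filter using \<gamma>(1) by blast
  qed
  with A show ?thesis unfolding has_op_integral_def by blast
qed

text \<open>
  Convergence of the Riemann sums in operator norm implies their convergence at each pair \<open>w\<close>, \<open>v\<close>, and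
  both notions of integral use the same filter of tagged divisions.  In particular an operator
  integral is determined on \<^const>\<open>H10\<close>, whichever one a choice operator picks.
\<close>

lemma has_op_integral_pointwise:
  assumes \<Omega>: "open \<Omega>" and T: "\<And>\<xi>. \<xi> \<in> {0..1} \<Longrightarrow> T \<xi> \<in> bounded_operators \<Omega>"
    and A: "has_op_integral \<Omega> T A" and w: "w \<in> H10 \<Omega>" and v: "v \<in> H10 \<Omega>"
  shows "((\<lambda>\<xi>. T \<xi> w v) has_integral A w v) {0..1}"
proof -
  define S where "S p w v = (\<Sum>(\<xi>,K)\<in>p. measure lborel K * T \<xi> w v)" for p :: "(real \<times> real set) set" and w v
  have "((\<lambda>p. S p w v - A w v) \<longlongrightarrow> 0) (division_filter {0..1})"
  proof (rule Lim_null_comparison)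
    show "\<forall>\<^sub>F p in division_filter {0..1}. norm (S p w v - A w v)
        \<le> op_norm \<Omega> (\<lambda>w v. S p w v - A w v) * (H1_norm \<Omega> w * H1_norm \<Omega> v)"
      using eventually_division_filter_tagged_division
    proof (rule eventually_mono)
      fix p assume p: "p tagged_division_of {0..1::real}"
      have "(\<lambda>w v. S p w v - A w v) \<in> bounded_operators \<Omega>"
        unfolding S_def using A
        by (intro bounded_operators_diff[OF \<Omega>] tagged_division_sum_bounded_operator[OF \<Omega> T p])
           (simp_all add: has_op_integral_def)
      from op_norm_bound[OF \<Omega> this w v]
      show "norm (S p w v - A w v) \<le> op_norm \<Omega> (\<lambda>w v. S p w v - A w v) * (H1_norm \<Omega> w * H1_norm \<Omega> v)"
        by (simp add: mult.assoc)
    qed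
    have "((\<lambda>p. op_norm \<Omega> (\<lambda>w v. S p w v - A w v)) \<longlongrightarrow> 0) (division_filter {0..1})"
      using A by (simp add: has_op_integral_def S_def)
    then show "((\<lambda>p. op_norm \<Omega> (\<lambda>w v. S p w v - A w v) * (H1_norm \<Omega> w * H1_norm \<Omega> v)) \<longlongrightarrow> 0)
        (division_filter {0..1})"
      by (rule tendsto_mult_left_zero)
  qed
  then have "((\<lambda>p. S p w v) \<longlongrightarrow> A w v) (division_filter {0..1})"
    by (rule LIM_zero_cancel)
  then show ?thesis
    using has_integral_cbox[of "\<lambda>\<xi>. T \<xi> w v" "A w v" 0 1] by (simp add: S_def)
qed

section \<open>The mean value identity for the averaged linearization\<close>

lemma H10_line:
  assumes "open \<Omega>" "u \<in> H10 \<Omega>" "d \<in> H10 \<Omega>"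
  shows "(\<lambda>x. u x + t * d x) \<in> H10 \<Omega>"
  using assms by (intro H10_add H10_scale)

text \<open>
  The chain rule along a line.  The remainder of the Frechet derivative at the point with parameter
  \<open>t\<close>, for the increment \<open>(s - t) d\<close>, is a functional whose norm is small relative to \<open>|s - t|\<close>;
  evaluating it at \<open>v\<close> costs only the constant factor \<open>H1_norm \<Omega> v\<close>.
\<close>

lemma C1_operator_line_derivative:
  assumes \<Omega>: "open \<Omega>" and F: "C1_operator \<Omega> F DF"
    and u: "u \<in> H10 \<Omega>" and d: "d \<in> H10 \<Omega>" and v: "v \<in> H10 \<Omega>"
  shows "((\<lambda>t. F (\<lambda>x. u x + t * d x) v) has_vector_derivative DF (\<lambda>x. u x + t * d x) d v) (at t within S)"
  unfolding has_vector_derivative_def has_derivative_within_alt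
proof (intro conjI allI impI)
  define y where "y t = (\<lambda>x. u x + t * d x)" for t
  have y: "y t \<in> H10 \<Omega>" for t unfolding y_def by (rule H10_line[OF \<Omega> u d])
  have FH: "F z \<in> Hm1 \<Omega>" if "z \<in> H10 \<Omega>" for z using F that by (simp add: C1_operator_def)
  have fr: "has_frechet_derivative_at \<Omega> F (DF (y t)) (y t)"
    using F y by (simp add: C1_operator_def)
  then have Tb: "DF (y t) \<in> bounded_operators \<Omega>" by (simp add: has_frechet_derivative_at_def)
  show "bounded_linear (\<lambda>h. h *\<^sub>R DF (\<lambda>x. u x + t * d x) d v)" by (rule bounded_linear_scaleR_left)
  fix e :: real assume e: "0 < e"
  define M where "M = H1_norm \<Omega> d * H1_norm \<Omega> v"
  have nn: "0 \<le> H1_norm \<Omega> d" "0 \<le> H1_norm \<Omega> v" using d v by (auto intro: H10_norm_nonneg)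
  then have M: "0 \<le> M" by (simp add: M_def)
  \<comment> \<open>Adding 1 to the norms keeps the divisors positive when a norm is zero.\<close>
  have e': "0 < e / (M + 1)" using e M by simp
  from fr e' obtain r where r: "r > 0" "\<And>h. h \<in> H10 \<Omega> \<Longrightarrow> H1_norm \<Omega> h < r \<Longrightarrow>
      Hm1_norm \<Omega> (\<lambda>v. F (\<lambda>x. y t x + h x) v - F (y t) v - DF (y t) h v) \<le> e / (M + 1) * H1_norm \<Omega> h"
    unfolding has_frechet_derivative_at_def by blast
  show "\<exists>r>0. \<forall>s\<in>S. norm (s - t) < r \<longrightarrow>
      norm (F (\<lambda>x. u x + s * d x) v - F (\<lambda>x. u x + t * d x) v - (s - t) *\<^sub>R DF (\<lambda>x. u x + t * d x) d v)
      \<le> e * norm (s - t)"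
  proof (intro exI[of _ "r / (H1_norm \<Omega> d + 1)"] conjI ballI impI)
    show "0 < r / (H1_norm \<Omega> d + 1)" using r nn by simp
    fix s assume st: "norm (s - t) < r / (H1_norm \<Omega> d + 1)"
    define h where "h = (\<lambda>x. (s - t) * d x)"
    have h: "h \<in> H10 \<Omega>" unfolding h_def by (rule H10_scale[OF \<Omega> d])
    have Nh: "H1_norm \<Omega> h = \<bar>s - t\<bar> * H1_norm \<Omega> d" unfolding h_def by (rule H10_norm_scale[OF d])
    have "\<bar>s - t\<bar> * H1_norm \<Omega> d \<le> \<bar>s - t\<bar> * (H1_norm \<Omega> d + 1)"
      by (intro mult_left_mono) auto
    also have "\<dots> < r" using st nn by (simp add: pos_less_divide_eq)
    finally have Nr: "H1_norm \<Omega> h < r" by (simp add: Nh)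
    have ys: "(\<lambda>x. y t x + h x) = y s" by (auto simp: y_def h_def algebra_simps)
    define L where "L = (\<lambda>v. F (y s) v - F (y t) v - DF (y t) h v)"
    have L: "L \<in> Hm1 \<Omega>"
      using Hm1_combine[OF Hm1_combine[OF FH[OF y[of s]] FH[OF y[of t]], of "-1"]
          bounded_operatorsD(1)[OF Tb h], of "-1"] by (simp add: L_def)
    have "\<bar>L v\<bar> \<le> Hm1_norm \<Omega> L * H1_norm \<Omega> v" by (rule Hm1_norm_bound[OF \<Omega> L v])
    also have "\<dots> \<le> (e / (M + 1) * H1_norm \<Omega> h) * H1_norm \<Omega> v"
      using r(2)[OF h Nr] nn by (intro mult_right_mono) (auto simp: ys L_def)
    also have "\<dots> = e * \<bar>s - t\<bar> * (M / (M + 1))" by (simp add: Nh M_def)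
    also have "\<dots> \<le> e * \<bar>s - t\<bar> * 1" using e M by (intro mult_left_mono) auto
    finally have "\<bar>L v\<bar> \<le> e * \<bar>s - t\<bar>" by simp
    moreover have "DF (y t) h v = (s - t) * DF (y t) d v"
      unfolding h_def by (rule bounded_operatorsD(3)[OF Tb d v])
    ultimately show "norm (F (\<lambda>x. u x + s * d x) v - F (\<lambda>x. u x + t * d x) v
        - (s - t) *\<^sub>R DF (\<lambda>x. u x + t * d x) d v) \<le> e * norm (s - t)"
      by (simp add: L_def y_def)
  qed
qed

lemma C1_operator_line_continuous:
  assumes \<Omega>: "open \<Omega>" and F: "C1_operator \<Omega> F DF" and u: "u \<in> H10 \<Omega>" and d: "d \<in> H10 \<Omega>" and e: "e > 0"
  shows "\<exists>r>0. \<forall>s. \<bar>s - t\<bar> < r \<longrightarrow>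
    op_norm \<Omega> (\<lambda>w v. DF (\<lambda>x. u x + s * d x) w v - DF (\<lambda>x. u x + t * d x) w v) < e"
proof -
  define y where "y t = (\<lambda>x. u x + t * d x)" for t
  have y: "y t \<in> H10 \<Omega>" for t unfolding y_def by (rule H10_line[OF \<Omega> u d])
  obtain r where r: "r > 0" "\<And>z. z \<in> H10 \<Omega> \<Longrightarrow> H1_norm \<Omega> (\<lambda>x. z x - y t x) < r \<Longrightarrow>
      op_norm \<Omega> (\<lambda>w v. DF z w v - DF (y t) w v) < e"
    using F y[of t] e unfolding C1_operator_def by blast
  have nn: "0 \<le> H1_norm \<Omega> d" by (rule H10_norm_nonneg[OF d])
  have "op_norm \<Omega> (\<lambda>w v. DF (y s) w v - DF (y t) w v) < e" if st: "\<bar>s - t\<bar> < r / (H1_norm \<Omega> d + 1)" for s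
  proof (rule r(2)[OF y])
    have "(\<lambda>x. y s x - y t x) = (\<lambda>x. (s - t) * d x)" by (auto simp: y_def algebra_simps)
    then have "H1_norm \<Omega> (\<lambda>x. y s x - y t x) = \<bar>s - t\<bar> * H1_norm \<Omega> d"
      by (simp add: H10_norm_scale[OF d])
    also have "\<dots> \<le> \<bar>s - t\<bar> * (H1_norm \<Omega> d + 1)" by (intro mult_left_mono) auto
    also have "\<dots> < r" using st nn by (simp add: pos_less_divide_eq)
    finally show "H1_norm \<Omega> (\<lambda>x. y s x - y t x) < r" .
  qed
  moreover have "0 < r / (H1_norm \<Omega> d + 1)" using r nn by simp
  ultimately show ?thesis unfolding y_def by blast
qed

text \<open>
  The mean value identity $\<A>(w - u) = F(w) - F(u)$.  Continuity of the derivative along the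
  segment provides an operator integral, so the chosen one really is an integral; tested with \<open>v\<close> it
  is the integral of the derivative of $\<xi> \<mapsto> \<langle>F(u + \<xi>(w - u)), v\<rangle>$, which the fundamental theorem of
  calculus evaluates.
\<close>

lemma averaged_linearization_mean_value:
  assumes \<Omega>: "open \<Omega>" and F: "C1_operator \<Omega> F DF" and u: "u \<in> H10 \<Omega>" and w: "w \<in> H10 \<Omega>"
  shows "averaged_linearization \<Omega> DF u w \<in> bounded_operators \<Omega>"
    and "v \<in> H10 \<Omega> \<Longrightarrow> averaged_linearization \<Omega> DF u w (\<lambda>x. w x - u x) v = F w v - F u v"
proof -
  define d where "d = (\<lambda>x. w x - u x)"
  have d: "d \<in> H10 \<Omega>" unfolding d_def by (rule H10_diff[OF \<Omega> w u])
  define T where "T \<xi> = DF (\<lambda>x. u x + \<xi> * d x)" for \<xi>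
  have T: "T \<xi> \<in> bounded_operators \<Omega>" for \<xi>
    using F H10_line[OF \<Omega> u d] by (simp add: T_def C1_operator_def has_frechet_derivative_at_def)
  have A_eq: "averaged_linearization \<Omega> DF u w = op_integral \<Omega> T"
    by (simp add: averaged_linearization_def T_def[abs_def] d_def)
  have "\<exists>A. has_op_integral \<Omega> T A"
  proof (rule has_op_integral_of_continuous[OF \<Omega> T])
    fix \<xi> e :: real assume "e > 0"
    from C1_operator_line_continuous[OF \<Omega> F u d this, of \<xi>]
    show "\<exists>r>0. \<forall>\<eta>\<in>{0..1}. \<bar>\<eta> - \<xi>\<bar> < r \<longrightarrow> op_norm \<Omega> (\<lambda>w v. T \<eta> w v - T \<xi> w v) < e"
      unfolding T_def by blast
  qed
  then have A: "has_op_integral \<Omega> T (op_integral \<Omega> T)"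
    unfolding op_integral_def by (rule someI_ex)
  then show "averaged_linearization \<Omega> DF u w \<in> bounded_operators \<Omega>"
    by (simp add: A_eq has_op_integral_def)
  assume v: "v \<in> H10 \<Omega>"
  have "((\<lambda>\<xi>. T \<xi> d v) has_integral op_integral \<Omega> T d v) {0..1}"
    by (rule has_op_integral_pointwise[OF \<Omega> T A d v])
  moreover have "((\<lambda>\<xi>. T \<xi> d v) has_integral F (\<lambda>x. u x + 1 * d x) v - F (\<lambda>x. u x + 0 * d x) v) {0..1}"
    unfolding T_def
    by (rule fundamental_theorem_of_calculus) (auto intro: C1_operator_line_derivative[OF \<Omega> F u d v])
  ultimately have "op_integral \<Omega> T d v = F (\<lambda>x. u x + 1 * d x) v - F (\<lambda>x. u x + 0 * d x) v"
    by (rule has_integral_unique)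
  then show "averaged_linearization \<Omega> DF u w (\<lambda>x. w x - u x) v = F w v - F u v"
    unfolding A_eq by (simp add: d_def)
qed

section \<open>The error representation\<close>

theorem theorem4p1:
  fixes \<Omega> :: "(real ^ 'd) set"
    and F :: "(real ^ 'd \<Rightarrow> real) \<Rightarrow> (real ^ 'd \<Rightarrow> real) \<Rightarrow> real"
    and DF :: "(real ^ 'd \<Rightarrow> real) \<Rightarrow> (real ^ 'd \<Rightarrow> real) \<Rightarrow> (real ^ 'd \<Rightarrow> real) \<Rightarrow> real"
    and u \<psi> :: "real ^ 'd \<Rightarrow> real"
    and p :: nat
    and \<Omega>i :: "nat \<Rightarrow> (real ^ 'd) set"
    and \<phi> ug \<omega> :: "nat \<Rightarrow> real ^ 'd \<Rightarrow> real"
    and Vg :: "nat \<Rightarrow> (real ^ 'd \<Rightarrow> real) set"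
    and upp :: "real ^ 'd \<Rightarrow> real"
    and l :: "(real ^ 'd \<Rightarrow> real) \<Rightarrow> real"
    and A :: "nat \<Rightarrow> (real ^ 'd \<Rightarrow> real) \<Rightarrow> (real ^ 'd \<Rightarrow> real) \<Rightarrow> real"
  assumes "open \<Omega>"
    and "C1_operator \<Omega> F DF"
    and "u \<in> H10 \<Omega>"
    and "\<forall>v\<in>H10 \<Omega>. F u v = 0"
    and "open_cover \<Omega> p \<Omega>i"
    and "partition_of_unity \<Omega> p \<Omega>i \<phi>"
    and "\<forall>i\<in>{1..p}. Vg i \<subseteq> H10 \<Omega> \<and> fun_subspace (Vg i)"
    and "\<forall>i\<in>{1..p}. ug i \<in> Vg i \<and> (\<forall>v\<in>Vg i. F (ug i) v = 0)"
    and "upp = (\<lambda>x. \<Sum>i=1..p. \<phi> i x * ug i x)"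
    and "\<psi> \<in> L2 \<Omega>"
    and "\<forall>v\<in>L2 \<Omega>. l v = L2_inner \<Omega> v \<psi>"
    and "\<forall>i\<in>{1..p}. A i = averaged_linearization \<Omega> DF u (ug i)"
    and "\<forall>i\<in>{1..p}. \<omega> i \<in> H10 \<Omega> \<and>
           (\<forall>v\<in>H10 \<Omega>. adjoint_op (A i) (\<omega> i) v = L2_inner \<Omega> (\<lambda>x. \<phi> i x * \<psi> x) v)"
  shows "l (\<lambda>x. u x - upp x) = - (\<Sum>i=1..p. F (ug i) (\<omega> i)) \<and>
    (\<forall>\<epsilon>>0. (\<forall>i\<in>{1..p}. \<bar>F (ug i) (\<omega> i)\<bar> < \<epsilon> / real p) \<longrightarrow>
       \<bar>l (\<lambda>x. u x - upp x)\<bar> < \<epsilon>)"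
proof -
  note \<Omega> = assms(1) and F = assms(2) and u = assms(3) and Fu = assms(4) and pou = assms(6)
    and \<psi> = assms(10)
  have ug: "ug i \<in> H10 \<Omega>" if "i \<in> {1..p}" for i
    using assms(7,8) that by blast
  have \<omega>: "\<omega> i \<in> H10 \<Omega>" if "i \<in> {1..p}" for i
    using assms(13) that by blast
  have cut: "(\<lambda>x. \<phi> i x * f x) \<in> L2 \<Omega>" if "i \<in> {1..p}" "f \<in> L2 \<Omega>" for i f
    using pou that by (intro L2_bounded_continuous_mult[OF \<Omega>]) (auto simp: partition_of_unity_def)
  have local_error: "L2_inner \<Omega> (\<lambda>x. \<phi> i x * (u x - ug i x)) \<psi> = - F (ug i) (\<omega> i)"
    if i: "i \<in> {1..p}" for i
  proof -
    have A: "A i = averaged_linearization \<Omega> DF u (ug i)"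
      using assms(12) i by blast
    note mean = averaged_linearization_mean_value[OF \<Omega> F u ug[OF i], folded A]
    have e: "(\<lambda>x. ug i x - u x) \<in> H10 \<Omega>" by (rule H10_diff[OF \<Omega> ug[OF i] u])
    \<comment> \<open>The product of the partition function and the error need not lie in the trial space, the error does.\<close>
    have "L2_inner \<Omega> (\<lambda>x. \<phi> i x * (u x - ug i x)) \<psi>
        = L2_inner \<Omega> (\<lambda>x. \<phi> i x * \<psi> x) (\<lambda>x. u x - ug i x)"
      by (rule L2_inner_cong) (simp add: mult_ac)
    also have "\<dots> = A i (\<lambda>x. u x - ug i x) (\<omega> i)"
      using assms(13) i H10_diff[OF \<Omega> u ug[OF i]] by (simp add: adjoint_op_def)
    also have "\<dots> = - A i (\<lambda>x. ug i x - u x) (\<omega> i)"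
      using bounded_operatorsD(3)[OF mean(1) e \<omega>[OF i], of "-1"] by simp
    also have "\<dots> = - F (ug i) (\<omega> i)"
      using mean(2)[OF \<omega>[OF i]] Fu \<omega>[OF i] by simp
    finally show ?thesis .
  qed
  have upp: "upp \<in> L2 \<Omega>"
    unfolding assms(9) by (intro L2_sum cut H10_L2 ug)
  have "l (\<lambda>x. u x - upp x) = L2_inner \<Omega> (\<lambda>x. u x - upp x) \<psi>"
    using assms(11) L2_diff[OF H10_L2[OF u] upp] by blast
  also have "\<dots> = L2_inner \<Omega> (\<lambda>x. \<Sum>i=1..p. \<phi> i x * (u x - ug i x)) \<psi>"
  proof (rule L2_inner_cong)
    fix x assume "x \<in> \<Omega>"
    then have "(\<Sum>i=1..p. \<phi> i x) = 1" using pou by (simp add: partition_of_unity_def)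
    then have "u x = (\<Sum>i=1..p. \<phi> i x * u x)" by (simp add: sum_distrib_right[symmetric])
    then show "(u x - upp x) * \<psi> x = (\<Sum>i=1..p. \<phi> i x * (u x - ug i x)) * \<psi> x"
      by (simp add: assms(9) right_diff_distrib sum_subtractf)
  qed
  also have "\<dots> = (\<Sum>i=1..p. L2_inner \<Omega> (\<lambda>x. \<phi> i x * (u x - ug i x)) \<psi>)"
    by (intro L2_inner_sum_left cut L2_diff H10_L2 ug u \<psi>)
  also have "\<dots> = - (\<Sum>i=1..p. F (ug i) (\<omega> i))"
    by (simp add: local_error sum_negf)
  finally have repr: "l (\<lambda>x. u x - upp x) = - (\<Sum>i=1..p. F (ug i) (\<omega> i))" .
  have "\<bar>l (\<lambda>x. u x - upp x)\<bar> < \<epsilon>"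
    if \<epsilon>: "\<epsilon> > 0" "\<forall>i\<in>{1..p}. \<bar>F (ug i) (\<omega> i)\<bar> < \<epsilon> / real p" for \<epsilon>
  \<comment> \<open>For \<open>p = 0\<close> the sum is empty, so the strict bound comes from \<open>\<epsilon>\<close> being positive.\<close>
  proof (cases "p = 0")
    case False
    have "\<bar>\<Sum>i=1..p. F (ug i) (\<omega> i)\<bar> \<le> (\<Sum>i=1..p. \<bar>F (ug i) (\<omega> i)\<bar>)" by (rule sum_abs)
    also have "\<dots> < (\<Sum>i=1..p. \<epsilon> / real p)"
      using \<epsilon>(2) False by (intro sum_strict_mono) auto
    also have "\<dots> = \<epsilon>" using False by simp
    finally show ?thesis by (simp add: repr)
  qed (use repr \<epsilon>(1) in simp)
  with repr show ?thesis by blast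
qed

end
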